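(* Let $A$ be an endomorphism of a finite dimensional vector space $V$ over a field $\mathbb{F}$. Assume that the minimal polynomial of $A$ is $m_A=p^k$ with $k\ge 1$ and $p\in\mathbb{F}[x]$ irreducible and separable. Then the following two statements are equivalent: (1) $\operatorname{Chinv}_{\mathbb{F}}(A)\setminus\operatorname{Hinv}_{\mathbb{F}}(A)\neq\emptyset$. (2) $\mathbb{F}=GF(2)$, $\deg(p)=1$, and, for some positive integers $r$ and $s$ with $s>r+1$, the Jordan form of $A$ contains exactly one Jordan block of size $s$ and exactly one Jordan block of size $r$.
   Context: A polynomial is separable if it is coprime with its derivative. $GF(2)$ is the field with two elements. A subspace $Y\subseteq V$ is hyperinvariant with respect to $A$ if $BY\subseteq Y$ for every $\mathbb{F}$-linear endomorphism $B$ of $V$ with $AB=BA$. A subspace $Y\subseteq V$ is characteristic with respect to $A$ if $AY\subseteq Y$ and $BY\subseteq Y$ for every $\mathbb{F}$-linear automorphism $B$ of $V$ with $AB=BA$. $\operatorname{Hinv}_{\mathbb{F}}(A)$ and $\operatorname{Chinv}_{\mathbb{F}}(A)$ denote the lattices of hyperinvariant and of characteristic subspaces, respectively. When $\deg(p)=1$, $A$ has a single eigenvalue $a\in\mathbb{F}$ and admits a Jordan form over $\mathbb{F}$; its block sizes are those of the nilpotent endomorphism $A-aI$. *)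

theory Defs
  imports "HOL.Vector_Spaces" "HOL-Computational_Algebra.Polynomial"
    "Jordan_Normal_Form.Jordan_Normal_Form"
begin

text \<open>The definitions take the scalar multiplication as an explicit argument: \<open>linear\<close>,
  \<open>subspace\<close>, \<open>span\<close> and so on without qualification would refer to real vector spaces.\<close>

definition endomorphism :: "('f::field \<Rightarrow> 'v::ab_group_add \<Rightarrow> 'v) \<Rightarrow> ('v \<Rightarrow> 'v) \<Rightarrow> bool" where
  "endomorphism scale A \<longleftrightarrow> Vector_Spaces.linear scale scale A"

definition automorphism :: "('f::field \<Rightarrow> 'v::ab_group_add \<Rightarrow> 'v) \<Rightarrow> ('v \<Rightarrow> 'v) \<Rightarrow> bool" where
  "automorphism scale A \<longleftrightarrow> endomorphism scale A \<and> bij A"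

definition Hinv :: "('f::field \<Rightarrow> 'v::ab_group_add \<Rightarrow> 'v) \<Rightarrow> ('v \<Rightarrow> 'v) \<Rightarrow> 'v set set" where
  "Hinv scale A = {Y. module.subspace scale Y \<and>
     (\<forall>B. endomorphism scale B \<and> A \<circ> B = B \<circ> A \<longrightarrow> B ` Y \<subseteq> Y)}"

definition Chinv :: "('f::field \<Rightarrow> 'v::ab_group_add \<Rightarrow> 'v) \<Rightarrow> ('v \<Rightarrow> 'v) \<Rightarrow> 'v set set" where
  "Chinv scale A = {Y. module.subspace scale Y \<and> A ` Y \<subseteq> Y \<and>
     (\<forall>B. automorphism scale B \<and> A \<circ> B = B \<circ> A \<longrightarrow> B ` Y \<subseteq> Y)}"

text \<open>The value \<open>q(A)\<close> of a polynomial at an endomorphism.\<close>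
definition poly_endo ::
    "('f::field \<Rightarrow> 'v::ab_group_add \<Rightarrow> 'v) \<Rightarrow> 'f poly \<Rightarrow> ('v \<Rightarrow> 'v) \<Rightarrow> 'v \<Rightarrow> 'v" where
  "poly_endo scale q A v = (\<Sum>i\<le>degree q. scale (coeff q i) ((A ^^ i) v))"

definition is_minimal_polynomial ::
    "('f::field \<Rightarrow> 'v::ab_group_add \<Rightarrow> 'v) \<Rightarrow> ('v \<Rightarrow> 'v) \<Rightarrow> 'f poly \<Rightarrow> bool" where
  "is_minimal_polynomial scale A m \<longleftrightarrow>
     lead_coeff m = 1 \<and> (\<forall>v. poly_endo scale m A v = 0) \<and>
     (\<forall>q. q \<noteq> 0 \<and> (\<forall>v. poly_endo scale q A v = 0) \<longrightarrow> degree m \<le> degree q)"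

definition separable_poly :: "'f::field poly \<Rightarrow> bool" where
  "separable_poly p \<longleftrightarrow> coprime p (pderiv p)"

definition ordered_basis :: "('f::field \<Rightarrow> 'v::ab_group_add \<Rightarrow> 'v) \<Rightarrow> 'v list \<Rightarrow> bool" where
  "ordered_basis scale bs \<longleftrightarrow>
     distinct bs \<and> \<not> module.dependent scale (set bs) \<and> module.span scale (set bs) = UNIV"

text \<open>Column \<open>j\<close> holds the coordinates of the image of the \<open>j\<close>-th basis vector.\<close>
definition matrix_of_endo ::
    "('f::field \<Rightarrow> 'v::ab_group_add \<Rightarrow> 'v) \<Rightarrow> 'v list \<Rightarrow> ('v \<Rightarrow> 'v) \<Rightarrow> 'f mat" where
  "matrix_of_endo scale bs A = mat (length bs) (length bs)
     (\<lambda>(i, j). module.representation scale (set bs) (A (bs ! j)) (bs ! i))"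

text \<open>A Jordan form is given by its list of blocks, i.e. of pairs (size, eigenvalue); all sizes
  are positive by \<open>jordan_nf_def\<close>. Since \<open>jordan_nf\<close> is similarity to the Jordan matrix,
  the choice of the basis is immaterial.\<close>
definition jordan_form ::
    "('f::field \<Rightarrow> 'v::ab_group_add \<Rightarrow> 'v) \<Rightarrow> ('v \<Rightarrow> 'v) \<Rightarrow> (nat \<times> 'f) list \<Rightarrow> bool" where
  "jordan_form scale A n_as \<longleftrightarrow>
     (\<exists>bs. ordered_basis scale bs \<and> jordan_nf (matrix_of_endo scale bs A) n_as)"

text \<open>The number of Jordan blocks of size \<open>t\<close>, for any eigenvalue.\<close>
definition num_blocks :: "(nat \<times> 'f) list \<Rightarrow> nat \<Rightarrow> nat" where
  "num_blocks n_as t = count_list (map fst n_as) t"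

end

theory Submission
  imports Defs "Jordan_Normal_Form.Jordan_Normal_Form_Existence"
begin

text \<open>
  Both notions only depend on the endomorphisms that commute with \<open>A\<close>: hyperinvariance is
  invariance under the whole centralizer, characteristicity is invariance under \<open>A\<close> and under the
  units of the centralizer. So the question is how much of the centralizer is forced to act on a
  subspace \<open>Y\<close> once its units do. A nilpotent \<open>B\<close> in the centralizer always acts, since \<open>1 + B\<close> is
  a unit, and Fitting's decomposition then reduces invariance under any \<open>B\<close> to invariance under the
  idempotents of the centralizer (\<open>characteristic_hyperinvariantI\<close>).

  If some polynomial \<open>D\<close> in \<open>A\<close> is such that \<open>D\<close> and \<open>D - 1\<close> are both invertible, then for an
  idempotent \<open>P\<close> the map \<open>1 + (D - 1) P\<close> is a unit, hence \<open>P\<close> acts on \<open>Y\<close>, and every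
  characteristic subspace is hyperinvariant. Such a \<open>D\<close> exists as soon as the residue field
  \<open>F[x]/(p)\<close> has a third element: a scalar other than 0 and 1 if \<open>F\<close> has one, and \<open>A\<close> itself if
  \<open>deg p > 1\<close> (\<open>characteristic_imp_hyperinvariant\<close>).

  There remains \<open>F = GF(2)\<close> and \<open>p = x - a\<close>. Then \<open>N = A - a\<close> is nilpotent with the same
  centralizer, and a Jordan basis splits the space into cyclic summands with generators \<open>e b\<close> of
  order \<open>t b\<close>. A map from one summand to a different one has square zero, so it acts on \<open>Y\<close>, and
  only the projections to the summands are in question. If two summands have equal length, their
  projections are products of maps between them. If only one length occurs just once, its
  projection is the identity minus the others. If the lengths that occur just once are \<open>r\<close> and
  \<open>r + 1\<close>, the two maps between these summands are so close to being mutually inverse that they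
  separate the two components of any vector of \<open>Y\<close>
  (\<open>characteristic_imp_hyperinvariant_if_no_gap\<close>).

  Conversely let \<open>r\<close> and \<open>s > r + 1\<close> each be the length of exactly one summand, with generators
  \<open>e i\<close> and \<open>e j\<close>. The vectors \<open>e i\<close> and \<open>N (e j)\<close> lie in a hyperinvariant subspace \<open>X\<close> in which
  two hyperinvariant subspaces \<open>K\<close> and \<open>L\<close> cut out subspaces of codimension one, with \<open>e i\<close> only in
  \<open>L\<close> and \<open>N (e j)\<close> only in \<open>K\<close>. Over \<open>GF(2)\<close> exactly one further subspace of codimension one in \<open>X\<close>
  contains the common part of these two. An automorphism that commutes with \<open>A\<close> preserves \<open>X\<close>, \<open>K\<close>
  and \<open>L\<close>, hence this third subspace too; but the projection to the \<open>i\<close>-th summand moves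
  its element \<open>e i + N (e j)\<close> to \<open>e i\<close> (\<open>gap_imp_characteristic_not_hyperinvariant\<close>).
\<close>

section \<open>Centralizers, characteristic and hyperinvariant subspaces\<close>

definition centralizer :: "('f::field \<Rightarrow> 'v::ab_group_add \<Rightarrow> 'v) \<Rightarrow> ('v \<Rightarrow> 'v) \<Rightarrow> ('v \<Rightarrow> 'v) set" where
  "centralizer scale N = {B. endomorphism scale B \<and> (\<forall>v. B (N v) = N (B v))}"

definition characteristic :: "('f::field \<Rightarrow> 'v::ab_group_add \<Rightarrow> 'v) \<Rightarrow> ('v \<Rightarrow> 'v) \<Rightarrow> 'v set \<Rightarrow> bool" where
  "characteristic scale N Y \<longleftrightarrow> module.subspace scale Y \<and> (\<forall>y\<in>Y. N y \<in> Y) \<and>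
     (\<forall>B\<in>centralizer scale N. bij B \<longrightarrow> (\<forall>y\<in>Y. B y \<in> Y))"

definition hyperinvariant :: "('f::field \<Rightarrow> 'v::ab_group_add \<Rightarrow> 'v) \<Rightarrow> ('v \<Rightarrow> 'v) \<Rightarrow> 'v set \<Rightarrow> bool" where
  "hyperinvariant scale N Y \<longleftrightarrow> module.subspace scale Y \<and> (\<forall>B\<in>centralizer scale N. \<forall>y\<in>Y. B y \<in> Y)"

context finite_dimensional_vector_space
begin

lemma comp_commute_iff: "A \<circ> B = B \<circ> A \<longleftrightarrow> (\<forall>v. B (A v) = A (B v))"
  by (auto simp: fun_eq_iff o_def)

lemma Chinv_iff: "Y \<in> Chinv scale A \<longleftrightarrow> characteristic scale A Y"
  unfolding Chinv_def characteristic_def centralizer_def automorphism_def comp_commute_iff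
  by blast

lemma Hinv_iff: "Y \<in> Hinv scale A \<longleftrightarrow> hyperinvariant scale A Y"
  unfolding Hinv_def hyperinvariant_def centralizer_def comp_commute_iff by blast

lemma endomorphism_iff: "endomorphism scale f \<longleftrightarrow>
    (\<forall>x y. f (x + y) = f x + f y) \<and> (\<forall>c x. f (scale c x) = scale c (f x))"
  by (simp add: endomorphism_def Vector_Spaces.linear_iff vector_space_axioms)

context
  fixes f
  assumes f: "endomorphism scale f"
begin

lemma endo_add: "f (x + y) = f x + f y"
  and endo_scale: "f (scale c x) = scale c (f x)"
  using f by (auto simp: endomorphism_iff)

lemma endo_zero: "f 0 = 0"
  using endo_add[of 0 0] by simp

lemma endo_neg: "f (- x) = - f x"
  using endo_add[of x "- x"] by (simp add: endo_zero eq_neg_iff_add_eq_0 add.commute)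

lemma endo_diff: "f (x - y) = f x - f y"
  using endo_add[of x "- y"] by (simp add: endo_neg)

lemma endo_sum: "f (sum g S) = (\<Sum>i\<in>S. f (g i))"
  by (induction S rule: infinite_finite_induct) (auto simp: endo_zero endo_add)

lemmas endo_simps = endo_add endo_scale endo_zero endo_neg endo_diff endo_sum

lemma subspace_range_endo: "subspace (range f)"
  unfolding subspace_def by (auto simp: image_iff) (metis endo_zero endo_add endo_scale)+

lemma subspace_kernel_endo: "subspace {v. f v = 0}"
  unfolding subspace_def by (auto simp: endo_simps)

end

lemma centralizerI:
  assumes "\<And>x y. B (x + y) = B x + B y" "\<And>c x. B (scale c x) = scale c (B x)"
    "\<And>v. B (N v) = N (B v)"
  shows "B \<in> centralizer scale N"
  using assms by (auto simp: centralizer_def endomorphism_iff)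

lemma centralizer_endo: "B \<in> centralizer scale N \<Longrightarrow> endomorphism scale B"
  and centralizer_commute: "B \<in> centralizer scale N \<Longrightarrow> B (N v) = N (B v)"
  by (auto simp: centralizer_def)

lemmas centralizer_simps = endo_simps[OF centralizer_endo]

lemma centralizer_self: "endomorphism scale N \<Longrightarrow> N \<in> centralizer scale N"
  by (auto simp: centralizer_def)

lemma centralizer_id: "(\<lambda>v. v) \<in> centralizer scale N"
  by (auto intro: centralizerI)

lemma centralizer_comp:
  assumes "B \<in> centralizer scale N" "C \<in> centralizer scale N"
  shows "(\<lambda>v. B (C v)) \<in> centralizer scale N"
  by (rule centralizerI)
    (simp_all add: assms[THEN centralizer_simps(1)] assms[THEN centralizer_simps(2)]
      assms[THEN centralizer_commute])

lemma centralizer_funpow: "B \<in> centralizer scale N \<Longrightarrow> B ^^ n \<in> centralizer scale N"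
proof (induction n)
  case 0
  then show ?case by (auto simp: id_def intro: centralizer_id)
next
  case (Suc n)
  then show ?case using centralizer_comp[of B N "B ^^ n"] by (simp add: o_def)
qed

context
  fixes N
  assumes N: "endomorphism scale N"
begin

lemma centralizer_add:
  assumes "B \<in> centralizer scale N" "C \<in> centralizer scale N"
  shows "(\<lambda>v. B v + C v) \<in> centralizer scale N"
  by (rule centralizerI)
    (simp_all add: assms[THEN centralizer_simps(1)] assms[THEN centralizer_simps(2)]
      assms[THEN centralizer_commute] endo_simps[OF N] scale_right_distrib)

lemma centralizer_diff:
  assumes "B \<in> centralizer scale N" "C \<in> centralizer scale N"
  shows "(\<lambda>v. B v - C v) \<in> centralizer scale N"
  by (rule centralizerI)
    (simp_all add: assms[THEN centralizer_simps(1)] assms[THEN centralizer_simps(2)]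
      assms[THEN centralizer_commute] endo_simps[OF N] scale_right_diff_distrib)

lemma centralizer_sum:
  "(\<And>i. i \<in> I \<Longrightarrow> B i \<in> centralizer scale N) \<Longrightarrow> (\<lambda>v. \<Sum>i\<in>I. B i v) \<in> centralizer scale N"
proof (induction I rule: infinite_finite_induct)
  case (insert i I)
  then show ?case using centralizer_add[of "B i" "\<lambda>v. \<Sum>i\<in>I. B i v"] by auto
qed (auto intro!: centralizerI simp: endo_zero[OF N])

lemma centralizer_scale: "(\<lambda>v. scale c v) \<in> centralizer scale N"
  by (rule centralizerI) (auto simp: endo_simps[OF N] scale_right_distrib mult.commute)

end

text \<open>The eigenvalue can be subtracted: all notions in play depend only on the centralizer and
  on invariance under the endomorphism itself.\<close>

lemma centralizer_shift:
  assumes "endomorphism scale A"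
  shows "centralizer scale (\<lambda>v. A v - scale a v) = centralizer scale A"
proof -
  have "(\<forall>v. B (A v - scale a v) = A (B v) - scale a (B v)) \<longleftrightarrow> (\<forall>v. B (A v) = A (B v))"
    if "endomorphism scale B" for B
    using that by (simp add: endo_simps)
  then show ?thesis unfolding centralizer_def by blast
qed

lemma characteristic_shift:
  assumes "endomorphism scale A"
  shows "characteristic scale (\<lambda>v. A v - scale a v) Y \<longleftrightarrow> characteristic scale A Y"
proof -
  have "(\<forall>y\<in>Y. A y - scale a y \<in> Y) \<longleftrightarrow> (\<forall>y\<in>Y. A y \<in> Y)" if Y: "subspace Y"
    by (metis subspace_diff[OF Y] subspace_add[OF Y] subspace_scale[OF Y] diff_add_cancel)
  then show ?thesis unfolding characteristic_def centralizer_shift[OF assms] by blast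
qed

lemma hyperinvariant_shift:
  "endomorphism scale A \<Longrightarrow> hyperinvariant scale (\<lambda>v. A v - scale a v) Y \<longleftrightarrow> hyperinvariant scale A Y"
  unfolding hyperinvariant_def by (simp add: centralizer_shift)

section \<open>Polynomials in an endomorphism\<close>

lemma poly_endo_bound:
  assumes "degree q \<le> n"
  shows "poly_endo scale q N v = (\<Sum>i\<le>n. scale (coeff q i) ((N ^^ i) v))"
  unfolding poly_endo_def using assms
  by (intro sum.mono_neutral_left) (auto simp: coeff_eq_0)

lemma poly_endo_0 [simp]: "poly_endo scale 0 N v = 0"
  by (simp add: poly_endo_def)

context
  fixes N
  assumes N: "endomorphism scale N"
begin

lemma poly_endo_pCons:
  "poly_endo scale (pCons c q) N v = scale c v + N (poly_endo scale q N v)"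
proof -
  have "poly_endo scale (pCons c q) N v =
      (\<Sum>i\<le>Suc (degree q). scale (coeff (pCons c q) i) ((N ^^ i) v))"
    by (rule poly_endo_bound) (rule degree_pCons_le)
  also have "\<dots> = scale c v + N (poly_endo scale q N v)"
    unfolding sum.atMost_Suc_shift poly_endo_def by (simp add: endo_simps[OF N])
  finally show ?thesis .
qed

lemma poly_endo_1: "poly_endo scale 1 N v = v"
  unfolding one_pCons by (simp add: poly_endo_pCons endo_zero[OF N])

lemma poly_endo_add:
  "poly_endo scale (p + q) N v = poly_endo scale p N v + poly_endo scale q N v"
proof (induction p arbitrary: q)
  case (pCons c p)
  show ?case
    by (cases q) (simp add: poly_endo_pCons pCons.IH scale_left_distrib endo_add[OF N])
qed simp

lemma poly_endo_smult: "poly_endo scale (Polynomial.smult c p) N v = scale c (poly_endo scale p N v)"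
  by (induction p) (simp_all add: poly_endo_pCons scale_right_distrib endo_scale[OF N])

lemma poly_endo_diff:
  "poly_endo scale (p - q) N v = poly_endo scale p N v - poly_endo scale q N v"
  using poly_endo_add[of "p - q" q v] by (simp add: eq_diff_eq)

lemma poly_endo_mult:
  "poly_endo scale (p * q) N v = poly_endo scale p N (poly_endo scale q N v)"
  by (induction p) (simp_all add: poly_endo_pCons poly_endo_add poly_endo_smult)

lemma poly_endo_commute:
  assumes B: "B \<in> centralizer scale N"
  shows "B (poly_endo scale q N v) = poly_endo scale q N (B v)"
  by (induction q) (simp_all add: poly_endo_pCons centralizer_simps[OF B] centralizer_commute[OF B])

lemma poly_endo_in_centralizer: "poly_endo scale q N \<in> centralizer scale N"
proof (induction q)
  case 0
  then show ?case by (auto intro!: centralizerI simp: endo_zero[OF N])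
next
  case (pCons c q)
  have "poly_endo scale (pCons c q) N = (\<lambda>v. scale c v + N (poly_endo scale q N v))"
    by (simp add: fun_eq_iff poly_endo_pCons)
  then show ?case
    using centralizer_add[OF N centralizer_scale[OF N]
        centralizer_comp[OF centralizer_self[OF N] pCons.IH]] by simp
qed

lemma poly_endo_invariant:
  assumes "subspace Y" "\<And>y. y \<in> Y \<Longrightarrow> N y \<in> Y" "y \<in> Y"
  shows "poly_endo scale q N y \<in> Y"
  using assms(3)
  by (induction q) (auto simp: poly_endo_pCons subspace_0[OF assms(1)]
      intro!: subspace_add[OF assms(1)] subspace_scale[OF assms(1)] assms(2))

lemma poly_endo_linear_power:
  "poly_endo scale ([:- a, 1:] ^ n) N v = ((\<lambda>v. N v - scale a v) ^^ n) v"
  by (induction n)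
    (simp_all only: power_Suc power_0 poly_endo_mult poly_endo_1 funpow.simps id_def o_def,
     simp add: poly_endo_pCons endo_zero[OF N])

end

lemma poly_endo_monom_power:
  "endomorphism scale N \<Longrightarrow> poly_endo scale ([:0, 1:] ^ n) N v = (N ^^ n) v"
  using poly_endo_linear_power[of N 0 n v] by simp

section \<open>Reduction to commuting projections\<close>

lemma centralizer_bij:
  assumes B: "B \<in> centralizer scale N" and inj: "\<And>v. B v = 0 \<Longrightarrow> v = 0"
  shows "bij B"
proof -
  have "inj B"
  proof (rule injI)
    fix x y assume "B x = B y"
    then have "B (x - y) = 0" by (simp add: centralizer_simps[OF B])
    from inj[OF this] show "x = y" by simp
  qed
  moreover from this have "surj B"
    using linear_inj_imp_surj B by (auto simp: centralizer_def endomorphism_def)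
  ultimately show ?thesis by (simp add: bij_def)
qed

text \<open>The basic way to act on a characteristic subspace by a non-invertible map: if \<open>B\<close> is nilpotent
  then \<open>1 + B\<close> is a unit of the centralizer, and \<open>B = (1 + B) - 1\<close>.\<close>

lemma characteristic_nilpotent:
  assumes Y: "characteristic scale N Y" and N: "endomorphism scale N"
    and B: "B \<in> centralizer scale N" and nil: "\<And>v. (B ^^ n) v = 0" and y: "y \<in> Y"
  shows "B y \<in> Y"
proof -
  have cent: "(\<lambda>v. v + B v) \<in> centralizer scale N"
    by (rule centralizer_add[OF N centralizer_id B])
  have "bij (\<lambda>v. v + B v)"
  proof (rule centralizer_bij[OF cent])
    fix v assume v: "v + B v = 0"
    have *: "(B ^^ i) v = v \<or> (B ^^ i) v = - v" for i
    proof (induction i)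
      case (Suc i)
      have "B v = - v" using v by (simp add: eq_neg_iff_add_eq_0 add.commute)
      then show ?case using Suc by (auto simp: centralizer_simps[OF B])
    qed simp
    show "v = 0" using *[of n] nil[of v] by auto
  qed
  then have "y + B y \<in> Y" using Y y cent by (auto simp: characteristic_def)
  then have "y + B y - y \<in> Y" using Y y by (intro subspace_diff) (auto simp: characteristic_def)
  then show ?thesis by simp
qed

text \<open>Fitting's decomposition of the space into the range and the kernel of a high power of \<open>B\<close>,
  given by the projection \<open>P\<close> to the range along the kernel. As \<open>P\<close> is determined by \<open>B\<close>, it
  commutes with everything that commutes with \<open>B\<close>, in particular with \<open>N\<close>.\<close>

lemma fitting_projection:
  assumes B: "B \<in> centralizer scale N"
  obtains n P where "n \<ge> 1" "P \<in> centralizer scale N" "\<And>v. P (P v) = P v" "\<And>v. B (P v) = P (B v)"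
    "\<And>v. (B ^^ n) (P v) = (B ^^ n) v" "\<And>v. (B ^^ n) (P v) = 0 \<Longrightarrow> P v = 0"
proof -
  note E = centralizer_endo[OF centralizer_funpow[OF B]]
  \<comment> \<open>Both summands are nonincreasing in \<open>n\<close>, so at a minimum of the sum the ranges and the
    kernels of the powers stabilise simultaneously. The restriction to \<open>n \<ge> 1\<close> makes a vector
    killed by \<open>B\<close> also killed by the chosen power.\<close>
  let ?d = "\<lambda>n. dim (range (B ^^ n)) + (dim (UNIV :: 'b set) - dim {v. (B ^^ n) v = 0})"
  obtain n where n1: "n \<ge> 1" and n: "\<And>m. m \<ge> 1 \<Longrightarrow> ?d n \<le> ?d m"
    using ex_has_least_nat[of "\<lambda>n. n \<ge> 1" 1 ?d] by auto
  define C where "C = B ^^ n"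
  have CC: "B ^^ (n + n) = (\<lambda>v. C (C v))" by (simp add: funpow_add C_def o_def)
  have C: "C \<in> centralizer scale N" unfolding C_def by (rule centralizer_funpow[OF B])
  note C0 = centralizer_simps[OF C]
  have r: "range (\<lambda>v. C (C v)) \<subseteq> range C" and k: "{v. C v = 0} \<subseteq> {v. C (C v) = 0}"
    by (auto simp: C0)
  have "?d n \<le> ?d (n + n)" by (rule n) (use n1 in simp)
  moreover have "dim {v. C (C v) = 0} \<le> dim (UNIV :: 'b set)" by (rule dim_subset) simp
  ultimately have "dim (range (\<lambda>v. C (C v))) \<ge> dim (range C)"
    "dim {v. C v = 0} \<ge> dim {v. C (C v) = 0}"
    using dim_subset[OF r] dim_subset[OF k] unfolding CC C_def[symmetric] by auto
  then have "range (\<lambda>v. C (C v)) = range C" "{v. C v = 0} = {v. C (C v) = 0}"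
    using subspace_dim_equal[OF _ _ r] subspace_dim_equal[OF _ _ k]
      subspace_range_endo[OF E[of n]] subspace_range_endo[OF E[of "n + n"]]
      subspace_kernel_endo[OF E[of n]] subspace_kernel_endo[OF E[of "n + n"]]
    unfolding CC C_def[symmetric] by auto
  then have surj: "\<exists>w. C v = C (C w)" and inj: "C (C v) = 0 \<Longrightarrow> C v = 0" for v by blast+
  have ex: "\<exists>x. x \<in> range C \<and> C x = C v" for v using surj[of v] by fastforce
  \<comment> \<open>On its range \<open>C\<close> is bijective, so \<open>C v\<close> has exactly one preimage there. The uniqueness
    \<open>PI\<close> gives linearity and all commutation rules.\<close>
  define P where "P v = (SOME x. x \<in> range C \<and> C x = C v)" for v
  have P: "P v \<in> range C" "C (P v) = C v" for v
    using someI_ex[OF ex[of v]] by (auto simp: P_def)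
  have PI: "P v = x" if "x \<in> range C" "C x = C v" for v x
  proof -
    from that(1) obtain u where "x = C u" by (rule rangeE)
    moreover from P(1)[of v] obtain w where "P v = C w" by (rule rangeE)
    moreover have "C (P v - x) = 0" using that(2) P(2)[of v] by (simp add: C0)
    ultimately have "P v - x = 0" using inj[of "w - u"] by (simp add: C0)
    then show ?thesis by simp
  qed
  have rangeC: "B x \<in> range C" if "x \<in> range C" "\<And>v. B (C v) = C (B v)" for x B
    using that by auto
  have BC: "B (C v) = C (B v)" for v by (simp add: C_def funpow_swap1)
  have "P \<in> centralizer scale N"
  proof (rule centralizerI; rule PI)
    fix x y v c
    show "P x + P y \<in> range C" using P(1)[of x] P(1)[of y] by (auto simp: C0[symmetric])
    show "C (P x + P y) = C (x + y)" by (simp add: C0 P)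
    show "scale c (P x) \<in> range C" using P(1)[of x] by (auto simp: C0[symmetric])
    show "C (scale c (P x)) = C (scale c x)" by (simp add: C0 P)
    show "N (P v) \<in> range C"
      by (rule rangeC[OF P(1)]) (simp add: centralizer_commute[OF C])
    show "C (N (P v)) = C (N v)" by (simp add: centralizer_commute[OF C] P)
  qed
  moreover have "P (P v) = P v" for v by (rule PI) (simp_all add: P)
  moreover have "B (P v) = P (B v)" for v
  proof (rule PI[symmetric])
    show "B (P v) \<in> range C" by (rule rangeC[OF P(1)]) (rule BC)
    show "C (B (P v)) = C (B v)" by (simp add: BC[symmetric] P)
  qed
  moreover have "P v = 0" if "C (P v) = 0" for v
  proof -
    obtain w where w: "P v = C w" using P(1)[of v] by (rule rangeE)
    show ?thesis using inj[of w] that unfolding w .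
  qed
  ultimately show thesis using n1 P(2) unfolding C_def by (intro that[of n P])
qed

text \<open>With the Fitting projection \<open>P\<close> of \<open>B\<close>, the part \<open>B (1 - P)\<close> is nilpotent and
  \<open>B P + (1 - P)\<close> is a unit. Both act on a characteristic subspace, so \<open>B\<close> acts if \<open>P\<close> does.\<close>

lemma characteristic_hyperinvariantI:
  assumes Y: "characteristic scale N Y" and N: "endomorphism scale N"
    and idem: "\<And>P y. P \<in> centralizer scale N \<Longrightarrow> (\<And>v. P (P v) = P v) \<Longrightarrow> y \<in> Y \<Longrightarrow> P y \<in> Y"
  shows "hyperinvariant scale N Y"
  unfolding hyperinvariant_def
proof (intro conjI ballI)
  show sub: "subspace Y" using Y by (simp add: characteristic_def)
  fix B y assume B: "B \<in> centralizer scale N" and y: "y \<in> Y"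
  obtain n P where n: "n \<ge> 1" and P: "P \<in> centralizer scale N" "\<And>v. P (P v) = P v"
    "\<And>v. B (P v) = P (B v)" "\<And>v. (B ^^ n) (P v) = (B ^^ n) v"
    "\<And>v. (B ^^ n) (P v) = 0 \<Longrightarrow> P v = 0"
    using fitting_projection[OF B] by blast
  note simps = centralizer_simps[OF B] centralizer_simps[OF P(1)]
  define R where "R v = v - P v" for v
  have R: "R \<in> centralizer scale N"
    unfolding R_def using centralizer_diff[OF N centralizer_id P(1)] .
  have BR: "(\<lambda>v. B (R v)) \<in> centralizer scale N" by (rule centralizer_comp[OF B R])
  have "((\<lambda>v. B (R v)) ^^ i) v = R ((B ^^ i) v)" if "i \<ge> 1" for i v
    using that
  proof (induction i rule: dec_induct)
    case (step i)
    then show ?case by (simp add: R_def simps P(2,3))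
  qed (simp add: R_def simps P(3))
  moreover have "R ((B ^^ n) v) = 0" for v
  proof -
    have "P ((B ^^ i) v) = (B ^^ i) (P v)" for i by (induction i) (simp_all add: P(3)[symmetric])
    then show ?thesis by (simp add: R_def P(4))
  qed
  ultimately have "((\<lambda>v. B (R v)) ^^ n) v = 0" for v using n by simp
  then have 1: "B (R y) \<in> Y" by (rule characteristic_nilpotent[OF Y N BR _ y])
  \<comment> \<open>\<open>B\<close> on the range of \<open>P\<close>, where it is invertible, and the identity on the kernel.\<close>
  define U where "U v = B (P v) + R v" for v
  have U: "U \<in> centralizer scale N"
    unfolding U_def by (rule centralizer_add[OF N centralizer_comp[OF B P(1)] R])
  have "bij U"
  proof (rule centralizer_bij[OF U])
    fix v assume v: "U v = 0"
    have BP: "B (P v) = 0"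
      using arg_cong[OF v, of P] by (simp add: U_def R_def simps P(2) P(3)[symmetric])
    have "(B ^^ n) (P v) = (B ^^ (n - 1)) (B (P v))"
      using n by (metis Suc_diff_1 funpow_Suc_right comp_apply less_eq_Suc_le One_nat_def)
    also have "\<dots> = 0"
      using BP endo_zero[OF centralizer_endo[OF centralizer_funpow[OF B]]] by simp
    finally have "P v = 0" by (rule P(5))
    then show "v = 0" using v BP by (simp add: U_def R_def)
  qed
  then have 2: "U y \<in> Y" using Y U y by (auto simp: characteristic_def)
  have 3: "P y \<in> Y" by (rule idem[OF P(1,2) y])
  have "B y = B (R y) + (U y - (y - P y))" by (simp add: U_def R_def simps)
  also have "\<dots> \<in> Y" by (intro subspace_add subspace_diff sub 1 2 3 y)
  finally show "B y \<in> Y" .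
qed

section \<open>Residue fields with more than two elements\<close>

text \<open>For an idempotent \<open>P\<close> and \<open>D = d(N)\<close> invertible, \<open>1 + (D - 1) P\<close> is a unit, so \<open>(D - 1) P\<close>
  acts on \<open>Y\<close>. The inverse \<open>r(N)\<close> of \<open>D - 1\<close> is a polynomial in \<open>N\<close>, so it acts as well, and it
  recovers \<open>P\<close>.\<close>

lemma characteristic_hyperinvariant_if_units:
  assumes Y: "characteristic scale N Y" and N: "endomorphism scale N"
    and inj: "\<And>v. poly_endo scale d N v = 0 \<Longrightarrow> v = 0"
    and inverse: "\<And>v. poly_endo scale r N (poly_endo scale d N v - v) = v"
  shows "hyperinvariant scale N Y"
proof (rule characteristic_hyperinvariantI[OF Y N])
  have sub: "subspace Y" and inv: "\<And>y. y \<in> Y \<Longrightarrow> N y \<in> Y"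
    using Y by (auto simp: characteristic_def)
  have pe: "poly_endo scale q N y \<in> Y" if "y \<in> Y" for q y
    by (rule poly_endo_invariant[OF N sub _ that]) (rule inv)
  fix P y assume P: "P \<in> centralizer scale N" "\<And>v. P (P v) = P v" and y: "y \<in> Y"
  let ?D = "poly_endo scale d N"
  have D: "?D \<in> centralizer scale N" by (rule poly_endo_in_centralizer[OF N])
  note simps = centralizer_simps[OF D] centralizer_simps[OF P(1)]
  \<comment> \<open>\<open>D\<close> on the range of \<open>P\<close> and the identity on the kernel, that is \<open>1 + (D - 1) P\<close>.\<close>
  define U where "U v = ?D (P v) + (v - P v)" for v
  have U: "U \<in> centralizer scale N"
    unfolding U_def by (rule centralizer_add[OF N centralizer_comp[OF D P(1)]
        centralizer_diff[OF N centralizer_id P(1)]])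
  have "bij U"
  proof (rule centralizer_bij[OF U])
    fix v assume v: "U v = 0"
    have "?D (P v) = 0"
      using arg_cong[OF v, of P] by (simp add: U_def simps P(2) poly_endo_commute[OF N P(1)])
    then have "P v = 0" by (rule inj)
    then show "v = 0" using v by (simp add: U_def simps)
  qed
  then have "U y \<in> Y" using Y U y by (auto simp: characteristic_def)
  then have "U y - y \<in> Y" by (intro subspace_diff sub y)
  then have "?D (P y) - P y \<in> Y" by (simp add: U_def algebra_simps)
  then have "poly_endo scale r N (?D (P y) - P y) \<in> Y"
    by (rule pe)
  then show "P y \<in> Y" unfolding inverse .
qed

text \<open>Dividing the annihilating polynomial \<open>m\<close> by \<open>x - a\<close> leaves the remainder \<open>m(a)\<close>, a unit, so the
  quotient is up to a scalar the inverse of \<open>N - a\<close>.\<close>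

lemma poly_endo_inverse_if_not_root:
  assumes N: "endomorphism scale N" and m: "\<And>v. poly_endo scale m N v = 0"
    and root: "poly m a \<noteq> 0"
  obtains r where "\<And>v. poly_endo scale r N (N v - scale a v) = v"
proof
  fix v
  let ?q = "synthetic_div m a"
  have m_eq: "m = ?q * [:- a, 1:] + [:poly m a:]"
    using synthetic_div_correct'[of a m] by (simp add: mult.commute)
  have "0 = poly_endo scale ?q N (N v - scale a v) + scale (poly m a) v"
    using m[of v] by (subst (asm) m_eq)
      (simp add: poly_endo_add[OF N] poly_endo_mult[OF N] poly_endo_pCons[OF N] endo_zero[OF N]
        del: mult_pCons_right)
  then have *: "poly_endo scale ?q N (N v - scale a v) = scale (- poly m a) v"
    by (simp add: eq_neg_iff_add_eq_0)
  have "poly_endo scale (Polynomial.smult (inverse (- poly m a)) ?q) N (N v - scale a v) =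
      scale (inverse (- poly m a) * - poly m a) v"
    by (simp only: poly_endo_smult[OF N] * scale_scale)
  also have "inverse (- poly m a) * - poly m a = 1" using root by (intro left_inverse) simp
  finally show "poly_endo scale (Polynomial.smult (inverse (- poly m a)) ?q) N (N v - scale a v) = v"
    by simp
qed

lemma irreducible_no_root:
  fixes p :: "'c::field poly"
  assumes "irreducible p" "degree p \<noteq> 1"
  shows "poly p a \<noteq> 0"
proof
  assume "poly p a = 0"
  then obtain q where q: "p = [:- a, 1:] * q" by (auto simp: poly_eq_0_iff_dvd)
  have "\<not> [:- a, 1:] dvd 1" by (simp add: is_unit_pCons_iff)
  then have "q dvd 1" using irreducibleD[OF assms(1) q] by blast
  then have "degree q = 0" by (simp add: poly_dvd_1)
  moreover have "q \<noteq> 0" using \<open>q dvd 1\<close> by auto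
  ultimately have "degree p = 1" unfolding q by (subst degree_mult_eq) auto
  with assms(2) show False by simp
qed

text \<open>A field element other than 0 and 1 serves as the unit \<open>D\<close>. If there is none, then \<open>p\<close> is
  irreducible of degree greater than one, has neither 0 nor 1 as a root, and \<open>D = N\<close> serves.\<close>

lemma characteristic_imp_hyperinvariant:
  fixes p :: "'a poly"
  assumes Y: "characteristic scale N Y" and N: "endomorphism scale N"
    and p: "irreducible p" "\<And>v. poly_endo scale (p ^ k) N v = 0"
    and not2: "card (UNIV :: 'a set) \<noteq> 2 \<or> degree p \<noteq> 1"
  shows "hyperinvariant scale N Y"
proof (cases "card (UNIV :: 'a set) = 2")
  case False
  have "\<exists>c::'a. c \<noteq> 0 \<and> c \<noteq> 1"
  proof (rule ccontr)
    assume "\<not> ?thesis"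
    then have "(UNIV :: 'a set) = {0, 1}" by auto
    with False show False by (metis card_2_iff zero_neq_one)
  qed
  then obtain c :: 'a where c: "c \<noteq> 0" "c \<noteq> 1" by blast
  have const: "poly_endo scale [:x:] N v = scale x v" for x v
    by (simp add: poly_endo_pCons[OF N] endo_zero[OF N])
  show ?thesis
  proof (rule characteristic_hyperinvariant_if_units[OF Y N, of "[:c:]" "[:inverse (c - 1):]"])
    fix v
    have "scale c v - v = scale (c - 1) v" by (simp add: scale_left_diff_distrib)
    then show "poly_endo scale [:inverse (c - 1):] N (poly_endo scale [:c:] N v - v) = v"
      using c by (simp add: const)
  qed (use c in \<open>auto simp: const\<close>)
next
  case True
  with not2 have "degree p \<noteq> 1" by simp
  then have root: "poly (p ^ k) a \<noteq> 0" for a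
    using irreducible_no_root[OF p(1)] by (simp add: poly_power)
  have X: "poly_endo scale [:0, 1:] N v = N v" for v
    by (simp add: poly_endo_pCons[OF N] endo_zero[OF N])
  obtain r0 where r0: "\<And>v. poly_endo scale r0 N (N v - scale 0 v) = v"
    using poly_endo_inverse_if_not_root[OF N p(2) root] by blast
  obtain r1 where r1: "\<And>v. poly_endo scale r1 N (N v - scale 1 v) = v"
    using poly_endo_inverse_if_not_root[OF N p(2) root] by blast
  show ?thesis
  proof (rule characteristic_hyperinvariant_if_units[OF Y N, of "[:0, 1:]" r1])
    fix v assume "poly_endo scale [:0, 1:] N v = 0"
    then show "v = 0"
      using r0[of v] endo_zero[OF centralizer_endo[OF poly_endo_in_centralizer[OF N]]]
      by (simp add: X)
  qed (use r1 in \<open>simp add: X\<close>)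
qed

end

section \<open>Divisibility modulo a power of the indeterminate\<close>

text \<open>The inverse of a power series with nonzero constant term, computed coefficient by coefficient.\<close>

lemma unit_mod_monom_power:
  fixes u :: "'c::field poly"
  assumes "poly u 0 \<noteq> 0"
  shows "\<exists>h. [:0, 1:] ^ K dvd h * u - 1"
proof (induction K)
  case (Suc K)
  then obtain h r where r: "h * u - 1 = [:0, 1:] ^ K * r" by (auto elim: dvdE)
  \<comment> \<open>Chosen so that the constant term of the error vanishes.\<close>
  define c where "c = poly r 0 / poly u 0"
  have "poly (r - [:c:] * u) 0 = 0" using assms by (simp add: c_def)
  then have "[:0, 1:] dvd r - [:c:] * u" using poly_eq_0_iff_dvd[of _ 0] by fastforce
  moreover have "(h - [:0, 1:] ^ K * [:c:]) * u - 1 = [:0, 1:] ^ K * (r - [:c:] * u)"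
  proof -
    have "(h - [:0, 1:] ^ K * [:c:]) * u - 1 = (h * u - 1) - [:0, 1:] ^ K * ([:c:] * u)"
      by (simp only: left_diff_distrib mult.assoc diff_diff_add add.commute)
    also have "\<dots> = [:0, 1:] ^ K * (r - [:c:] * u)"
      by (simp only: r right_diff_distrib)
    finally show ?thesis .
  qed
  ultimately have "[:0, 1:] ^ Suc K dvd (h - [:0, 1:] ^ K * [:c:]) * u - 1"
    by (simp only: power_Suc2 mult_dvd_mono dvd_refl)
  then show ?case by blast
qed simp

text \<open>Modulo \<open>x\<^sup>K\<close> every polynomial is a unit times a power of \<open>x\<close>, so of \<open>f\<close> and \<open>g\<close> either \<open>g\<close>
  divides \<open>f\<close>, or the valuation of \<open>g\<close> is strictly larger and even \<open>x f\<close> divides \<open>g\<close>.\<close>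

lemma monom_valuation_dichotomy:
  fixes f g :: "'c::field poly"
  shows "\<exists>h. [:0, 1:] ^ K dvd f - h * g \<or> [:0, 1:] ^ K dvd g - h * ([:0, 1:] * f)"
proof (cases "f = 0 \<or> g = 0")
  case True
  then show ?thesis by (intro exI[of _ 0]) auto
next
  case False
  define X :: "'c poly" where "X = [:0, 1:]"
  define a b where "a = order 0 f" and "b = order 0 g"
  obtain u where u: "f = X ^ a * u" "\<not> X dvd u"
    using order_decomp[of f 0] False by (auto simp: a_def X_def)
  obtain v where v: "g = X ^ b * v" "\<not> X dvd v"
    using order_decomp[of g 0] False by (auto simp: b_def X_def)
  obtain u' where u': "X ^ K dvd u' * u - 1"
    using unit_mod_monom_power[of u K] u(2) poly_eq_0_iff_dvd[of u 0] by (auto simp: X_def)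
  obtain v' where v': "X ^ K dvd v' * v - 1"
    using unit_mod_monom_power[of v K] v(2) poly_eq_0_iff_dvd[of v 0] by (auto simp: X_def)
  show ?thesis unfolding X_def[symmetric]
  proof (cases "b \<le> a")
    case True
    then obtain d where d: "a = b + d" using le_iff_add by blast
    have "f - (X ^ d * u * v') * g = - f * (v' * v - 1)"
      by (simp add: u v d power_add algebra_simps)
    then show "\<exists>h. X ^ K dvd f - h * g \<or> X ^ K dvd g - h * (X * f)" using v' by (metis dvd_mult)
  next
    case False
    then obtain d where d: "b = a + 1 + d" by (metis le_iff_add not_less Suc_leI Suc_eq_plus1)
    have "g - (X ^ d * v * u') * (X * f) = - g * (u' * u - 1)"
      by (simp add: u v d power_add algebra_simps)
    then show "\<exists>h. X ^ K dvd f - h * g \<or> X ^ K dvd g - h * (X * f)" using u' by (metis dvd_mult)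
  qed
qed

section \<open>Cyclic decompositions of a nilpotent endomorphism\<close>

text \<open>The space as a direct sum of cyclic modules over the polynomial ring, with \<open>e b\<close> generating a
  summand of length \<open>t b\<close>. Instead of linear independence of the powers the locale assumes the
  universal property of such a sum: an element of the centralizer can be prescribed on the
  generators, subject only to their orders.\<close>

locale cyclic_decomposition = finite_dimensional_vector_space scale Basis
  for scale :: "'f::field \<Rightarrow> 'v::ab_group_add \<Rightarrow> 'v" and Basis +
  fixes N :: "'v \<Rightarrow> 'v" and m :: nat and t :: "nat \<Rightarrow> nat" and e :: "nat \<Rightarrow> 'v"
  assumes N: "endomorphism scale N"
    and t_pos: "b < m \<Longrightarrow> 0 < t b"
    and power_t: "b < m \<Longrightarrow> (N ^^ t b) (e b) = 0"
    and power_less_t: "b < m \<Longrightarrow> (N ^^ (t b - 1)) (e b) \<noteq> 0"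
    and span_powers: "span {(N ^^ l) (e b) | b l. b < m} = UNIV"
    and ex_hom: "i < m \<Longrightarrow> (N ^^ t i) w = 0 \<Longrightarrow>
      \<exists>E\<in>centralizer scale N. E (e i) = w \<and> (\<forall>b<m. b \<noteq> i \<longrightarrow> E (e b) = 0)"
begin

lemmas N_simps = endo_simps[OF N]
lemmas N_self = centralizer_self[OF N]
lemmas Npow = centralizer_funpow[OF N_self]
lemmas Npow_simps = centralizer_simps[OF Npow]
lemmas pe_cent = poly_endo_in_centralizer[OF N]
lemmas pe_simps = centralizer_simps[OF pe_cent]

lemma pe_Npow: "poly_endo scale q N ((N ^^ n) v) = (N ^^ n) (poly_endo scale q N v)"
  by (rule poly_endo_commute[OF N Npow, symmetric])

lemma Npow_add: "(N ^^ (a + b)) v = (N ^^ a) ((N ^^ b) v)"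
  by (simp add: funpow_add)

lemma Npow_commute: "B \<in> centralizer scale N \<Longrightarrow> B ((N ^^ n) v) = (N ^^ n) (B v)"
  by (induction n) (simp_all add: centralizer_commute[of B N])

lemma Npow_zero_mono:
  assumes "(N ^^ a) v = 0" "a \<le> b"
  shows "(N ^^ b) v = 0"
  using Npow_add[of "b - a" a v] assms by (simp add: Npow_simps)

lemma centralizer_eqI:
  assumes B: "B \<in> centralizer scale N" and C: "C \<in> centralizer scale N"
    and eq: "\<And>b. b < m \<Longrightarrow> B (e b) = C (e b)"
  shows "B v = C v"
proof -
  have "Vector_Spaces.linear scale scale B" "Vector_Spaces.linear scale scale C"
    using B C by (auto simp: centralizer_def endomorphism_def)
  moreover have "v \<in> span {(N ^^ l) (e b) | b l. b < m}" unfolding span_powers ..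
  moreover have "B x = C x" if "x \<in> {(N ^^ l) (e b) | b l. b < m}" for x
    using that eq by (auto simp: Npow_commute[OF B] Npow_commute[OF C])
  ultimately show ?thesis
    by (rule vector_space_pair.linear_eq_on[OF vector_space_pair.intro,
          OF vector_space_axioms vector_space_axioms])
qed

text \<open>The map out of the \<open>i\<close>-th summand that sends its generator to \<open>w\<close>; it exists only when
  \<open>N ^^ t i\<close> kills \<open>w\<close>, and the value is arbitrary otherwise.\<close>

definition hom :: "nat \<Rightarrow> 'v \<Rightarrow> 'v \<Rightarrow> 'v" where
  "hom i w = (SOME E. E \<in> centralizer scale N \<and> E (e i) = w \<and> (\<forall>b<m. b \<noteq> i \<longrightarrow> E (e b) = 0))"

lemma hom:
  assumes "i < m" "(N ^^ t i) w = 0"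
  shows "hom i w \<in> centralizer scale N" "hom i w (e i) = w"
    "b < m \<Longrightarrow> b \<noteq> i \<Longrightarrow> hom i w (e b) = 0"
proof -
  have "\<exists>E. E \<in> centralizer scale N \<and> E (e i) = w \<and> (\<forall>b<m. b \<noteq> i \<longrightarrow> E (e b) = 0)"
    using ex_hom[OF assms] by blast
  from someI_ex[OF this]
  show "hom i w \<in> centralizer scale N" "hom i w (e i) = w"
    "b < m \<Longrightarrow> b \<noteq> i \<Longrightarrow> hom i w (e b) = 0"
    by (auto simp: hom_def)
qed

definition proj :: "nat \<Rightarrow> 'v \<Rightarrow> 'v" where
  "proj i = hom i (e i)"

lemma proj:
  assumes "i < m"
  shows "proj i \<in> centralizer scale N" "proj i (e i) = e i"
    "b < m \<Longrightarrow> b \<noteq> i \<Longrightarrow> proj i (e b) = 0"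
  using hom[OF assms power_t[OF assms]] by (auto simp: proj_def)

lemmas proj_simps = centralizer_simps[OF proj(1)]

lemma proj_gen: "i < m \<Longrightarrow> b < m \<Longrightarrow> proj i (e b) = (if b = i then e i else 0)"
  using proj by auto

lemma proj_proj:
  assumes "i < m" "b < m"
  shows "proj i (proj b v) = (if i = b then proj i v else 0)"
proof (cases "i = b")
  case True
  have "proj i (proj i v) = proj i v"
    by (rule centralizer_eqI[OF centralizer_comp[OF proj(1) proj(1)] proj(1)])
      (use assms in \<open>auto simp: proj_gen proj_simps\<close>)
  with True show ?thesis by simp
next
  case False
  have 0: "(\<lambda>v. 0) \<in> centralizer scale N" by (auto intro!: centralizerI simp: N_simps)
  have "proj i (proj b v) = 0"
    by (rule centralizer_eqI[OF centralizer_comp[OF proj(1) proj(1)] 0])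
      (use assms False in \<open>auto simp: proj_gen proj_simps\<close>)
  with False show ?thesis by simp
qed

lemma sum_proj: "(\<Sum>b<m. proj b v) = v"
proof (rule centralizer_eqI[OF centralizer_sum[OF N] centralizer_id])
  fix b assume "b < m"
  then have "(\<Sum>i<m. proj i (e b)) = (\<Sum>i<m. if b = i then e b else 0)"
    by (intro sum.cong) (auto simp: proj_gen)
  with \<open>b < m\<close> show "(\<Sum>i<m. proj i (e b)) = e b" by simp
qed (auto intro: proj)

lemma proj_poly:
  assumes b: "b < m"
  shows "\<exists>q. proj b v = poly_endo scale q N (e b)"
proof -
  have "v \<in> span {(N ^^ l) (e b) | b l. b < m}" unfolding span_powers ..
  then show ?thesis
  proof (induction rule: span_induct_alt)
    case base
    show ?case using poly_endo_0[of N "e b"] proj_simps[OF b] by metis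
  next
    case (step c x y)
    then obtain q where q: "proj b y = poly_endo scale q N (e b)" by blast
    have "\<exists>r. proj b x = poly_endo scale r N (e b)"
    proof -
      from step(1) obtain b' l where x: "x = (N ^^ l) (e b')" "b' < m" by blast
      then have "proj b x = (if b' = b then poly_endo scale ([:0, 1:] ^ l) N (e b)
          else poly_endo scale 0 N (e b))"
        using b by (simp only: Npow_commute[OF proj(1)] proj_gen poly_endo_monom_power[OF N] poly_endo_0)
          (auto simp: Npow_simps)
      then show ?thesis by (metis (full_types))
    qed
    then obtain r where r: "proj b x = poly_endo scale r N (e b)" by blast
    have "proj b (scale c x + y) = poly_endo scale (Polynomial.smult c r + q) N (e b)"
      using b by (simp add: proj_simps q r poly_endo_add[OF N] poly_endo_smult[OF N])
    then show ?case by blast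
  qed
qed

lemma proj_factor:
  assumes b: "b < m"
  obtains c z where "proj b v = scale c (e b) + N z" "proj b z = z"
proof -
  obtain q where q: "proj b v = poly_endo scale q N (e b)" using proj_poly[OF b] by blast
  show thesis
  proof (cases q)
    case (pCons c r)
    show thesis
    proof (rule that)
      show "proj b v = scale c (e b) + N (poly_endo scale r N (e b))"
        by (simp add: q pCons poly_endo_pCons[OF N])
      show "proj b (poly_endo scale r N (e b)) = poly_endo scale r N (e b)"
        using b by (simp add: poly_endo_commute[OF N proj(1)] proj_gen)
    qed
  qed
qed

lemma power_t_proj:
  assumes b: "b < m"
  shows "(N ^^ t b) (proj b v) = 0"
  using proj_poly[OF b, of v] power_t[OF b] by (auto simp: pe_Npow[symmetric] pe_simps)

text \<open>In a cyclic module of length \<open>t b\<close> the kernel of \<open>N ^^ (t b - h)\<close> is the range of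
  \<open>N ^^ h\<close>: a nonzero constant coefficient would survive up to the power \<open>t b - 1\<close>.\<close>

lemma proj_divisible:
  assumes b: "b < m" and x: "proj b x = x" and h: "h \<le> t b" "(N ^^ (t b - h)) x = 0"
  shows "\<exists>z. proj b z = z \<and> x = (N ^^ h) z"
  using h
proof (induction h)
  case 0
  with x show ?case by auto
next
  case (Suc h)
  have "(N ^^ (t b - h)) x = 0" by (rule Npow_zero_mono[OF Suc.prems(2)]) simp
  with Suc obtain z where z: "proj b z = z" "x = (N ^^ h) z" by auto
  obtain c z' where z': "z = scale c (e b) + N z'" "proj b z' = z'"
    using proj_factor[OF b, of z] z(1) by metis
  have "t b - Suc h + h = t b - 1" using Suc.prems by simp
  then have "(N ^^ (t b - 1)) z = 0" using Suc.prems(2) by (metis z(2) Npow_add)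
  moreover have "(N ^^ (t b - 1)) (N z') = 0"
    using power_t_proj[OF b, of z'] t_pos[OF b] z'(2)
    by (metis Suc_diff_1 comp_apply funpow_Suc_right)
  ultimately have "c = 0" using power_less_t[OF b] by (simp add: z' Npow_simps)
  then have "x = (N ^^ Suc h) z'" using z(2) z' by (simp add: funpow_swap1)
  with z'(2) show ?case by blast
qed

section \<open>Absence of a gap between unrepeated orders\<close>

definition unrepeated :: "nat \<Rightarrow> bool" where
  "unrepeated i \<longleftrightarrow> i < m \<and> (\<forall>b<m. t b = t i \<longrightarrow> b = i)"

context
  fixes Y
  assumes Y: "characteristic scale N Y"
begin

lemma subspace_Y: "subspace Y" using Y by (simp add: characteristic_def)

lemma poly_invariant: "y \<in> Y \<Longrightarrow> poly_endo scale q N y \<in> Y"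
  using poly_endo_invariant[OF N subspace_Y] Y by (auto simp: characteristic_def)

lemma square_zero_invariant:
  assumes "T \<in> centralizer scale N" "\<And>v. T (T v) = 0" "y \<in> Y"
  shows "T y \<in> Y"
  by (rule characteristic_nilpotent[OF Y N assms(1) _ assms(3), of 2])
    (simp add: numeral_2_eq_2 assms(2))

text \<open>Decompose \<open>B\<close> into its blocks \<open>proj j B proj i\<close>. The blocks off the diagonal have square zero,
  and those on the diagonal are polynomials in \<open>N\<close> because the endomorphism ring of a cyclic module
  is commutative.\<close>

lemma hyperinvariant_if_proj_invariant:
  assumes proj_Y: "\<And>i y. i < m \<Longrightarrow> y \<in> Y \<Longrightarrow> proj i y \<in> Y"
  shows "hyperinvariant scale N Y"
  unfolding hyperinvariant_def
proof (intro conjI ballI)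
  show "subspace Y" by (rule subspace_Y)
  fix B y assume B: "B \<in> centralizer scale N" and y: "y \<in> Y"
  have "proj j (B (proj i y)) \<in> Y" if ij: "i < m" "j < m" for i j
  proof (cases "i = j")
    case False
    have T: "(\<lambda>v. proj j (B (proj i v))) \<in> centralizer scale N"
      by (rule centralizer_comp[OF proj(1)[OF ij(2)] centralizer_comp[OF B proj(1)[OF ij(1)]]])
    show ?thesis
      by (rule square_zero_invariant[OF T _ y])
        (use ij False in \<open>simp add: proj_proj proj_simps centralizer_simps[OF B]\<close>)
  next
    case True
    obtain f where f: "proj i y = poly_endo scale f N (e i)" using proj_poly[OF ij(1)] by blast
    obtain g where g: "proj i (B (e i)) = poly_endo scale g N (e i)" using proj_poly[OF ij(1)]
      by blast
    have "proj i (B (proj i y)) = poly_endo scale f N (poly_endo scale g N (e i))"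
      using ij by (simp add: f g poly_endo_commute[OF N B] poly_endo_commute[OF N proj(1)])
    also have "\<dots> = poly_endo scale g N (proj i y)"
      by (simp add: f poly_endo_commute[OF N pe_cent])
    finally show ?thesis using True poly_invariant[OF proj_Y[OF ij(1) y]] by simp
  qed
  then have "(\<Sum>i<m. \<Sum>j<m. proj j (B (proj i y))) \<in> Y"
    by (auto intro!: subspace_sum[OF subspace_Y])
  also have "(\<Sum>i<m. \<Sum>j<m. proj j (B (proj i y))) = B y"
    by (simp add: sum_proj centralizer_simps(6)[OF B, symmetric])
  finally show "B y \<in> Y" .
qed

lemma hom_invariant:
  assumes ij: "i < m" "j < m" "i \<noteq> j" and w: "(N ^^ t i) w = 0" "proj j w = w" and y: "y \<in> Y"
  shows "hom i w y \<in> Y"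
proof (rule square_zero_invariant[OF _ _ y])
  note E = hom[OF ij(1) w(1)]
  show "hom i w \<in> centralizer scale N" by (rule E)
  have 0: "(\<lambda>v. 0) \<in> centralizer scale N" by (auto intro!: centralizerI simp: N_simps)
  obtain q where q: "w = poly_endo scale q N (e j)" using proj_poly[OF ij(2), of w] w(2) by metis
  have w0: "hom i w w = 0"
    by (subst (2) q) (use ij E(3)[of j] in \<open>simp add: poly_endo_commute[OF N E(1)] pe_simps\<close>)
  fix v
  show "hom i w (hom i w v) = 0"
  proof (rule centralizer_eqI[OF centralizer_comp[OF E(1) E(1)] 0])
    fix b assume "b < m"
    then show "hom i w (hom i w (e b)) = 0"
      by (cases "b = i") (simp_all add: E w0 centralizer_simps[OF E(1)])
  qed
qed

text \<open>Between two summands of equal length there are mutually inverse maps, so the projection factors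
  through the other summand, and both factors have square zero.\<close>

lemma proj_invariant_if_repeated:
  assumes ij: "i < m" "j < m" "i \<noteq> j" "t i = t j" and y: "y \<in> Y"
  shows "proj i y \<in> Y"
proof -
  have w: "(N ^^ t i) (e j) = 0" "(N ^^ t j) (e i) = 0"
    using power_t[OF ij(1)] power_t[OF ij(2)] ij(4) by simp_all
  note E = hom[OF ij(1) w(1)] and E' = hom[OF ij(2) w(2)]
  have "proj i y = hom j (e i) (hom i (e j) y)"
  proof (rule centralizer_eqI[OF proj(1)[OF ij(1)] centralizer_comp[OF E'(1) E(1)]])
    fix b assume "b < m"
    then show "proj i (e b) = hom j (e i) (hom i (e j) (e b))"
      using ij by (cases "b = i") (simp_all add: E E' proj_gen centralizer_simps[OF E'(1)])
  qed
  moreover have "hom i (e j) y \<in> Y" by (rule hom_invariant[OF ij(1-3) w(1) _ y])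
    (use ij in \<open>simp add: proj_gen\<close>)
  then have "hom j (e i) (hom i (e j) y) \<in> Y"
    by (rule hom_invariant[OF ij(2,1) ij(3)[symmetric] w(2), rotated])
      (use ij in \<open>simp add: proj_gen\<close>)
  ultimately show ?thesis by simp
qed

lemma pe_cong:
  assumes "[:0, 1:] ^ K dvd f - g" "(N ^^ K) v = 0"
  shows "poly_endo scale f N v = poly_endo scale g N v"
proof -
  obtain r where r: "f - g = r * [:0, 1:] ^ K" using assms(1)
    by (auto elim: dvdE simp: mult.commute)
  have "poly_endo scale (f - g) N v = 0"
    unfolding r poly_endo_mult[OF N] by (simp only: poly_endo_monom_power[OF N] assms(2) pe_simps)
  then show ?thesis by (simp add: poly_endo_diff[OF N])
qed

text \<open>When \<open>t j = t i + 1\<close> the summands are linked by \<open>e j \<mapsto> e i\<close> and \<open>e i \<mapsto> N (e j)\<close>, whose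
  composites are multiplication by \<open>N\<close>, the least possible defect from being inverse to each
  other. The strict alternative in \<open>monom_valuation_dichotomy\<close> matches it exactly.\<close>

lemma proj_invariant_if_adjacent:
  assumes ij: "i < m" "j < m" "t j = t i + 1"
    and others: "\<And>b. b < m \<Longrightarrow> b \<noteq> i \<Longrightarrow> b \<noteq> j \<Longrightarrow> proj b y \<in> Y"
    and y: "y \<in> Y"
  shows "proj i y \<in> Y" "proj j y \<in> Y"
proof -
  have ne: "i \<noteq> j" using ij by auto
  define y' where "y' = proj i y + proj j y"
  have "y = (\<Sum>b\<in>{..<m} - {i, j}. proj b y) + y'"
    using sum.subset_diff[of "{i, j}" "{..<m}" "\<lambda>b. proj b y"] ij ne by (simp add: sum_proj y'_def)
  then have "y' = y - (\<Sum>b\<in>{..<m} - {i, j}. proj b y)" by (metis add_diff_cancel_left')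
  then have y'Y: "y' \<in> Y"
    using others y by (auto intro!: subspace_diff[OF subspace_Y] subspace_sum[OF subspace_Y])
  obtain f where f: "proj i y = poly_endo scale f N (e i)" using proj_poly[OF ij(1)] by blast
  obtain g where g: "proj j y = poly_endo scale g N (e j)" using proj_poly[OF ij(2)] by blast
  have w: "(N ^^ t j) (e i) = 0" "(N ^^ t i) (N (e j)) = 0"
    using power_t[OF ij(1)] power_t[OF ij(2)] ij(3) by (simp_all add: N_simps funpow_swap1)
  note E = hom[OF ij(2) w(1)] and E' = hom[OF ij(1) w(2)]
  have EY: "hom j (e i) y' \<in> Y"
    by (rule hom_invariant[OF ij(2,1) ne[symmetric] w(1) _ y'Y]) (use ij in \<open>simp add: proj_gen\<close>)
  have E'Y: "hom i (N (e j)) y' \<in> Y"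
    by (rule hom_invariant[OF ij(1,2) ne w(2) _ y'Y])
      (use ij in \<open>simp add: proj_gen centralizer_commute[OF proj(1)]\<close>)
  \<comment> \<open>With \<open>y' = f(N) e\<^sub>i + g(N) e\<^sub>j\<close>, the map \<open>e\<^sub>j \<mapsto> e\<^sub>i\<close> yields \<open>g(N) e\<^sub>i\<close> in \<open>Y\<close> and the map
    \<open>e\<^sub>i \<mapsto> N e\<^sub>j\<close> yields \<open>f(N) N e\<^sub>j\<close> in \<open>Y\<close>. One of these is a divisor of the component wanted.\<close>
  obtain h where "[:0, 1:] ^ t j dvd f - h * g \<or> [:0, 1:] ^ t j dvd g - h * ([:0, 1:] * f)"
    using monom_valuation_dichotomy by blast
  then have "proj i y \<in> Y \<or> proj j y \<in> Y"
  proof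
    assume "[:0, 1:] ^ t j dvd f - h * g"
    then have "proj i y = poly_endo scale h N (poly_endo scale g N (e i))"
      unfolding f using pe_cong[of "t j" f "h * g"] w(1) by (simp add: poly_endo_mult[OF N])
    also have "poly_endo scale g N (e i) = hom j (e i) y'"
      using ij ne by (simp add: y'_def f g centralizer_simps[OF E(1)] poly_endo_commute[OF N E(1)]
          E pe_simps)
    finally show ?thesis using poly_invariant[OF EY] by simp
  next
    assume "[:0, 1:] ^ t j dvd g - h * ([:0, 1:] * f)"
    then have "[:0, 1:] ^ t j dvd g - h * (f * [:0, 1:])" by (simp only: mult.commute[of f])
    then have "proj j y = poly_endo scale h N (poly_endo scale f N (poly_endo scale [:0, 1:] N (e j)))"
      unfolding g using pe_cong[of "t j" g "h * (f * [:0, 1:])"] power_t[OF ij(2)]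
      by (simp only: poly_endo_mult[OF N] simp_thms)
    also have "poly_endo scale [:0, 1:] N (e j) = N (e j)"
      by (simp add: poly_endo_pCons[OF N] N_simps)
    also have "poly_endo scale f N (N (e j)) = hom i (N (e j)) y'"
      using ij ne by (simp add: y'_def f g centralizer_simps[OF E'(1)] poly_endo_commute[OF N E'(1)]
          E' pe_simps)
    finally show ?thesis using poly_invariant[OF E'Y] by simp
  qed
  moreover have "proj j y \<in> Y" if "proj i y \<in> Y"
    using subspace_diff[OF subspace_Y y'Y that] by (simp add: y'_def)
  moreover have "proj i y \<in> Y" if "proj j y \<in> Y"
    using subspace_diff[OF subspace_Y y'Y that] by (simp add: y'_def)
  ultimately show "proj i y \<in> Y" "proj j y \<in> Y" by blast+
qed

lemma characteristic_imp_hyperinvariant_if_no_gap: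
  assumes gap: "\<And>i j. unrepeated i \<Longrightarrow> unrepeated j \<Longrightarrow> t j \<le> t i + 1"
  shows "hyperinvariant scale N Y"
proof (rule hyperinvariant_if_proj_invariant)
  fix i y assume i: "i < m" and y: "y \<in> Y"
  have rep: "proj b y \<in> Y" if b: "b < m" "\<not> unrepeated b" for b
  proof -
    obtain j where "j < m" "t j = t b" "j \<noteq> b" using b unfolding unrepeated_def by blast
    then show ?thesis using proj_invariant_if_repeated[OF b(1), of j] y by simp
  qed
  consider "\<not> unrepeated i" | j where "unrepeated i" "unrepeated j" "j \<noteq> i"
    | "unrepeated i" "\<And>j. unrepeated j \<Longrightarrow> j = i" by blast
  then show "proj i y \<in> Y"
  proof cases
    case 1
    with rep i show ?thesis by blast
  next
    case 2
    then have ne: "t i \<noteq> t j" and j: "j < m" unfolding unrepeated_def by auto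
    have adj: "t j = t i + 1 \<or> t i = t j + 1" using gap[of i j] gap[of j i] 2 ne by linarith
    have "proj b y \<in> Y" if b: "b < m" "b \<noteq> i" "b \<noteq> j" for b
    proof (rule rep[OF b(1)], rule notI)
      \<comment> \<open>Three distinct numbers cannot pairwise differ by one.\<close>
      assume bu: "unrepeated b"
      then have "t b \<noteq> t i" "t b \<noteq> t j" using 2 b unfolding unrepeated_def by auto
      then show False using adj gap[OF bu 2(1)] gap[OF bu 2(2)] gap[OF 2(1) bu] gap[OF 2(2) bu]
        by linarith
    qed
    then show ?thesis
      using proj_invariant_if_adjacent(1)[OF i j _ _ y] proj_invariant_if_adjacent(2)[OF j i _ _ y] adj
        by blast
  next
    case 3
    have "(\<Sum>b\<in>{..<m} - {i}. proj b y) \<in> Y"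
      using rep 3(2) by (intro subspace_sum[OF subspace_Y]) auto
    moreover have "proj i y = y - (\<Sum>b\<in>{..<m} - {i}. proj b y)"
      using sum.remove[of "{..<m}" i "\<lambda>b. proj b y"] i by (simp add: sum_proj eq_diff_eq)
    ultimately show ?thesis using subspace_diff[OF subspace_Y y] by simp
  qed
qed

end

section \<open>A gap over the field with two elements\<close>

text \<open>In a cyclic summand of length \<open>n\<close> the sum of a kernel and a range is everything if \<open>n \<le> q\<close> and
  the range alone if \<open>n \<ge> q + h\<close>. So these hyperinvariant subspaces single out the low coefficients
  of the summands of large length.\<close>

definition ker_range :: "nat \<Rightarrow> nat \<Rightarrow> 'v set" where
  "ker_range q h = {x + (N ^^ h) z | x z. (N ^^ q) x = 0}"

lemma ker_range_I: "(N ^^ q) x = 0 \<Longrightarrow> x + (N ^^ h) z \<in> ker_range q h"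
  by (auto simp: ker_range_def)

lemma kernel_in_ker_range: "(N ^^ q) x = 0 \<Longrightarrow> x \<in> ker_range q h"
  using ker_range_I[of q x h 0] by (simp add: Npow_simps)

lemma range_in_ker_range: "(N ^^ h) z \<in> ker_range q h"
  using ker_range_I[of q 0 h z] by (simp add: Npow_simps)

lemma ker_range_E:
  assumes "v \<in> ker_range q h" obtains x z where "v = x + (N ^^ h) z" "(N ^^ q) x = 0"
  using assms by (auto simp: ker_range_def)

lemma centralizer_ker_range:
  assumes B: "B \<in> centralizer scale N" and v: "v \<in> ker_range q h"
  shows "B v \<in> ker_range q h"
proof -
  obtain x z where xz: "v = x + (N ^^ h) z" "(N ^^ q) x = 0" using ker_range_E[OF v] .
  have "(N ^^ q) (B x) = 0" using xz(2)
    by (simp add: Npow_commute[OF B, symmetric] centralizer_simps[OF B])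
  from ker_range_I[OF this, of h "B z"] show ?thesis
    by (simp add: xz centralizer_simps[OF B] Npow_commute[OF B])
qed

lemma subspace_ker_range: "subspace (ker_range q h)"
proof (rule subspaceI)
  show "0 \<in> ker_range q h" by (rule kernel_in_ker_range) (simp add: Npow_simps)
  fix c x assume "x \<in> ker_range q h"
  then show "scale c x \<in> ker_range q h" by (rule centralizer_ker_range[OF centralizer_scale[OF N]])
next
  fix u v assume "u \<in> ker_range q h" "v \<in> ker_range q h"
  then obtain x z x' z' where "u = x + (N ^^ h) z" "(N ^^ q) x = 0" "v = x' + (N ^^ h) z'" "(N ^^ q) x' = 0"
    by (metis ker_range_E)
  then show "u + v \<in> ker_range q h" using ker_range_I[of q "x + x'" h "z + z'"]
    by (simp add: Npow_simps algebra_simps)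
qed

text \<open>Makes membership in a subspace that is invariant under the centralizer unchanged by units in both
  directions, which is needed to preserve an equivalence of two memberships.\<close>

lemma centralizer_inv:
  assumes B: "B \<in> centralizer scale N" and bij: "bij B"
  shows "inv_into UNIV B \<in> centralizer scale N"
proof -
  have B_inv: "B (inv_into UNIV B v) = v" "inv_into UNIV B (B v) = v" for v
    using bij by (simp_all add: bij_is_surj surj_f_inv_f bij_is_inj)
  note simps = centralizer_simps[OF B] centralizer_commute[OF B] B_inv
  have I: "inv_into UNIV B x = y" if "B y = x" for x y using that B_inv by metis
  show ?thesis by (rule centralizerI; rule I) (simp_all add: simps)
qed

lemma centralizer_ker_range_iff:
  assumes B: "B \<in> centralizer scale N" "bij B"
  shows "B v \<in> ker_range q h \<longleftrightarrow> v \<in> ker_range q h"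
  using centralizer_ker_range[OF B(1)] centralizer_ker_range[OF centralizer_inv[OF B], of "B v"] B(2)
  by (auto simp: bij_is_inj)

lemma proj_in_range:
  assumes b: "b < m" and v: "v \<in> ker_range q h" and le: "q + h \<le> t b"
  shows "\<exists>z. proj b z = z \<and> proj b v = (N ^^ h) z"
proof -
  obtain x z where xz: "proj b v = x + (N ^^ h) z" "(N ^^ q) x = 0"
    using ker_range_E[OF centralizer_ker_range[OF proj(1)[OF b] v]] .
  have "(N ^^ q) (proj b x) = 0"
    using xz(2) by (simp add: Npow_commute[OF proj(1)[OF b], symmetric] proj_simps[OF b])
  then have "(N ^^ (t b - h)) (proj b x) = 0" by (rule Npow_zero_mono) (use le in simp)
  then obtain z' where z': "proj b z' = z'" "proj b x = (N ^^ h) z'"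
    using proj_divisible[OF b, of "proj b x" h] b le by (auto simp: proj_proj)
  have "proj b v = proj b (proj b v)" using b by (simp add: proj_proj)
  also have "\<dots> = (N ^^ h) (z' + proj b z)"
    using b by (simp add: xz(1) proj_simps Npow_simps Npow_commute[OF proj(1)] z'(2))
  finally show ?thesis using b z'(1)
    by (intro exI[of _ "z' + proj b z"]) (simp add: proj_simps proj_proj)
qed

lemma mem_ker_range_if_proj: "(\<And>b. b < m \<Longrightarrow> proj b v \<in> ker_range q h) \<Longrightarrow> v \<in> ker_range q h"
  using subspace_sum[OF subspace_ker_range, of "{..<m}" "\<lambda>b. proj b v" q h] by (simp add: sum_proj)

lemma power_notin_ker_range:
  assumes b: "b < m" and le: "q + h \<le> t b" "l < h"
  shows "(N ^^ l) (e b) \<notin> ker_range q h"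
proof
  assume v: "(N ^^ l) (e b) \<in> ker_range q h"
  obtain z where z: "proj b z = z" "proj b ((N ^^ l) (e b)) = (N ^^ h) z"
    using proj_in_range[OF b v le(1)] by blast
  have "(N ^^ l) (e b) = (N ^^ h) z" using z(2) b by (simp add: Npow_commute[OF proj(1)] proj_gen)
  then have "(N ^^ (t b - 1 - l + l)) (e b) = (N ^^ (t b - 1 - l + h)) z"
    by (simp only: Npow_add)
  moreover have "(N ^^ (t b - 1 - l + h)) z = 0"
    by (rule Npow_zero_mono[of "t b"]) (use power_t_proj[OF b, of z] z(1) le in auto)
  moreover have "t b - 1 - l + l = t b - 1" using le by simp
  ultimately show False using power_less_t[OF b] by simp
qed

text \<open>The defining condition of \<open>Y\<close> is an equivalence of two memberships in hyperinvariant subspaces.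
  Units preserve it at once. The two-element field enters in the closure of \<open>Y\<close> under addition: two
  vectors outside a subspace of codimension one have their sum inside.\<close>

lemma gap_imp_characteristic_not_hyperinvariant:
  assumes F2: "\<And>c::'f. c = 0 \<or> c = 1"
    and i: "unrepeated i" and j: "unrepeated j" and gap: "t i + 1 < t j"
  shows "\<exists>Y. characteristic scale N Y \<and> \<not> hyperinvariant scale N Y"
proof -
  have im: "i < m" and jm: "j < m" and ij: "i \<noteq> j" using i j gap by (auto simp: unrepeated_def)
  define r s where "r = t i" and "s = t j"
  have r: "r \<ge> 1" "s \<ge> r + 2" using t_pos[OF im] gap by (auto simp: r_def s_def)
  \<comment> \<open>Modulo \<open>K\<close> the only coordinate left in \<open>X\<close> is that of \<open>e i\<close>, and modulo \<open>L\<close> it is that of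
    \<open>N (e j)\<close>; so \<open>Y\<close> consists of the vectors on which these two coordinates agree.\<close>
  define X where "X = ker_range r 1 \<inter> ker_range (s - 1) 2"
  define K where "K = ker_range (r - 1) 1"
  define L where "L = ker_range (s - 2) 2"
  define Y where "Y = {v \<in> X. v \<in> K \<longleftrightarrow> v \<in> L}"
  have X: "subspace X" unfolding X_def by (intro subspace_inter subspace_ker_range)
  have K: "subspace K" and L: "subspace L" unfolding K_def L_def by (rule subspace_ker_range)+
  have N1: "(N ^^ 1) v = N v" "(N ^^ 2) v = N (N v)" for v by (simp_all add: numeral_2_eq_2)
  have XN: "\<exists>z. proj b v = N z \<and> proj b z = z" if "v \<in> X" "b < m" "t b > r" for b v
    using proj_in_range[of b v r 1] that by (auto simp: X_def)
  have XK: "\<exists>c. v - scale c (e i) \<in> K" if v: "v \<in> X" for v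
  proof -
    obtain c z where cz: "proj i v = scale c (e i) + N z" using proj_factor[OF im, of v] by metis
    have "proj b (v - scale c (e i)) \<in> K" if b: "b < m" for b
    proof (cases "b = i")
      case True
      then show ?thesis using cz range_in_ker_range[of 1 z "r - 1"] im
        by (simp add: proj_simps proj_gen K_def)
    next
      case False
      then have eq: "proj b (v - scale c (e i)) = proj b v" using b im
        by (simp add: proj_simps proj_gen)
      have "t b \<noteq> r" using i b False by (auto simp: unrepeated_def r_def)
      then consider "t b \<le> r - 1" | "t b > r" by linarith
      then show ?thesis unfolding eq
      proof cases
        case 1
        then show "proj b v \<in> K" unfolding K_def
          by (intro kernel_in_ker_range Npow_zero_mono[OF power_t_proj[OF b]])
      next
        case 2
        with XN[OF v b] show "proj b v \<in> K" using range_in_ker_range[of 1] by (auto simp: K_def)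
      qed
    qed
    then show ?thesis unfolding K_def by (blast intro: mem_ker_range_if_proj)
  qed
  have XL: "\<exists>c. v - scale c (N (e j)) \<in> L" if v: "v \<in> X" for v
  proof -
    obtain z where z: "proj j v = N z" "proj j z = z" using XN[OF v jm] r by (auto simp: s_def)
    obtain c z' where cz: "z = scale c (e j) + N z'" using proj_factor[OF jm, of z] z(2) by metis
    have "proj b (v - scale c (N (e j))) \<in> L" if b: "b < m" for b
    proof (cases "b = j")
      case True
      then show ?thesis using range_in_ker_range[of 2 z' "s - 2"] jm
        by (simp add: proj_simps proj_gen centralizer_commute[OF proj(1)] L_def z(1) cz N_simps N1)
    next
      case False
      then have eq: "proj b (v - scale c (N (e j))) = proj b v"
        using b jm by (simp add: proj_simps proj_gen centralizer_commute[OF proj(1)] N_simps)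
      have "t b \<noteq> s" using j b False by (auto simp: unrepeated_def s_def)
      \<comment> \<open>Summands of order \<open>s - 1\<close> are harmless because \<open>s - 1 > r\<close>: there the component of a
        vector of \<open>X\<close> is already divisible by \<open>N\<close>. This is where the gap is used.\<close>
      then consider "t b \<le> s - 2" | "t b = s - 1" | "t b > s" by linarith
      then show ?thesis unfolding eq
      proof cases
        case 1
        then show "proj b v \<in> L" unfolding L_def
          by (intro kernel_in_ker_range Npow_zero_mono[OF power_t_proj[OF b]])
      next
        case 2
        with r have "t b > r" by linarith
        with XN[OF v b] obtain y where y: "proj b v = N y" "proj b y = y" by blast
        have "Suc (s - 2) = t b" using 2 r by linarith
        then have "(N ^^ Suc (s - 2)) y = 0" using power_t_proj[OF b, of y] y(2) by simp
        then show "proj b v \<in> L" unfolding L_def y(1)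
          by (intro kernel_in_ker_range) (simp add: funpow_swap1)
      next
        case 3
        with r have "s - 1 + 2 \<le> t b" by linarith
        moreover have "v \<in> ker_range (s - 1) 2" using v by (simp add: X_def)
        ultimately have "\<exists>z. proj b v = (N ^^ 2) z" using proj_in_range[OF b] by blast
        then show "proj b v \<in> L" unfolding L_def by (auto simp: range_in_ker_range)
      qed
    qed
    then show ?thesis unfolding L_def by (blast intro: mem_ker_range_if_proj)
  qed
  have diff: "u - v \<in> M" if M: "subspace M" and uv: "u - scale c w \<in> M" "v - scale d w \<in> M" "u \<notin> M" "v \<notin> M"
    for M u v w c d
  proof -
    have "c \<noteq> 0" "d \<noteq> 0" using uv by auto
    then have "c = 1" "d = 1" using F2 by metis+
    then have "u - w \<in> M" "v - w \<in> M" using uv by simp_all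
    then have "(u - w) - (v - w) \<in> M" by (rule subspace_diff[OF M])
    then show ?thesis by simp
  qed
  have char2: "u + v = u - v" for u v :: 'v
  proof -
    have "(1::'f) + 1 \<noteq> 1" by (metis add.right_neutral add_left_cancel one_neq_zero)
    then have "(1::'f) + 1 = 0" using F2 by blast
    then have "v + v = 0" using scale_left_distrib[of 1 1 v] by simp
    then show ?thesis by (simp add: eq_diff_eq add.assoc)
  qed
  have add: "u + v \<in> M \<longleftrightarrow> (u \<in> M \<longleftrightarrow> v \<in> M)"
    if M: "subspace M" and uv: "u - scale c w \<in> M" "v - scale d w \<in> M" for M u v w c d
  proof (cases "u \<in> M \<or> v \<in> M")
    case True
    then show ?thesis using subspace_add[OF M, of u v] subspace_diff[OF M, of "u + v" u]
        subspace_diff[OF M, of "u + v" v] by auto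
  next
    case False
    then show ?thesis using diff[OF M uv] by (simp add: char2[of u v])
  qed
  have addK: "u + v \<in> K \<longleftrightarrow> (u \<in> K \<longleftrightarrow> v \<in> K)" and addL: "u + v \<in> L \<longleftrightarrow> (u \<in> L \<longleftrightarrow> v \<in> L)"
    if "u \<in> X" "v \<in> X" for u v
    using XK[OF that(1)] XK[OF that(2)] XL[OF that(1)] XL[OF that(2)] add[OF K] add[OF L] by blast+
  have Y: "subspace Y"
  proof (rule subspaceI)
    show "0 \<in> Y" using X K L by (simp add: Y_def subspace_0)
    show "u + v \<in> Y" if "u \<in> Y" "v \<in> Y" for u v
      using that addK addL subspace_add[OF X] by (auto simp: Y_def)
    show "scale c v \<in> Y" if "v \<in> Y" for c v
      using F2[of c] that \<open>0 \<in> Y\<close> by auto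
  qed
  have "characteristic scale N Y"
    unfolding characteristic_def
  proof (intro conjI ballI impI Y)
    fix y assume y: "y \<in> Y"
    then have yX: "y \<in> X" by (simp add: Y_def)
    then have NX: "N y \<in> X" unfolding X_def using centralizer_ker_range[OF N_self] by blast
    have NK: "N y \<in> K" unfolding K_def using range_in_ker_range[of 1] by simp
    obtain x z where xz: "y = x + (N ^^ 1) z" "(N ^^ r) x = 0" using yX ker_range_E[of y r 1]
      by (auto simp: X_def)
    have "(N ^^ Suc (s - 2)) x = 0" by (rule Npow_zero_mono[OF xz(2)]) (use r in simp)
    then have "N x + (N ^^ 2) z \<in> ker_range (s - 2) 2"
      by (intro ker_range_I) (simp add: funpow_swap1)
    then have "N y \<in> L" by (simp add: xz(1) L_def N_simps N1)
    with NX NK show "N y \<in> Y" by (simp add: Y_def)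
  next
    fix B y assume "B \<in> centralizer scale N" "bij B" "y \<in> Y"
    then show "B y \<in> Y" using centralizer_ker_range_iff[of B]
      by (auto simp: Y_def X_def K_def L_def)
  qed
  moreover have "\<not> hyperinvariant scale N Y"
  proof
    assume hyp: "hyperinvariant scale N Y"
    have "(N ^^ r) (e i) = 0" using power_t[OF im] by (simp add: r_def)
    then have "(N ^^ (s - 1)) (e i) = 0" "(N ^^ (s - 2)) (e i) = 0" "(N ^^ r) (e i) = 0"
      using r by (auto elim: Npow_zero_mono)
    then have ei: "e i \<in> X" "e i \<in> L" unfolding X_def L_def by (auto intro: kernel_in_ker_range)
    have "e i \<notin> K" using power_notin_ker_range[OF im, of "r - 1" 1 0] r by (simp add: K_def r_def)
    have "(N ^^ (s - 1)) (N (e j)) = (N ^^ Suc (s - 1)) (e j)" by (simp add: funpow_swap1)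
    also have "\<dots> = 0" using power_t[OF jm] t_pos[OF jm] by (simp add: s_def)
    finally have "(N ^^ (s - 1)) (N (e j)) = 0" .
    then have ej: "N (e j) \<in> X" "N (e j) \<in> K"
      using range_in_ker_range[of 1 "e j"] unfolding X_def K_def
        by (auto intro: kernel_in_ker_range)
    have "N (e j) \<notin> L" using power_notin_ker_range[OF jm, of "s - 2" 2 1] r
      by (simp add: L_def s_def)
    then have "e i + N (e j) \<in> Y"
      using ei ej \<open>e i \<notin> K\<close> addK addL subspace_add[OF X] by (auto simp: Y_def)
    then have "proj i (e i + N (e j)) \<in> Y" using hyp proj(1)[OF im]
      by (auto simp: hyperinvariant_def)
    also have "proj i (e i + N (e j)) = e i"
      using im jm ij by (simp add: proj_simps centralizer_commute[OF proj(1)] proj_gen N_simps)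
    finally show False using ei \<open>e i \<notin> K\<close> by (simp add: Y_def)
  qed
  ultimately show ?thesis by blast
qed

end

section \<open>Jordan forms and cyclic decompositions\<close>

context finite_dimensional_vector_space
begin

text \<open>The powers of the generators form a basis, so a linear map is free on them. The one induced by
  sending \<open>e i\<close> to \<open>w\<close> commutes with \<open>N\<close> at the end of the chain because \<open>w\<close> has the right order.\<close>

lemma cyclic_decompositionI:
  fixes N :: "'b \<Rightarrow> 'b" and e :: "nat \<Rightarrow> 'b"
  defines "u \<equiv> \<lambda>(b, l). (N ^^ l) (e b)"
  assumes N: "endomorphism scale N"
    and t: "\<And>b. b < m \<Longrightarrow> 0 < t b" "\<And>b. b < m \<Longrightarrow> (N ^^ t b) (e b) = 0"
    and I_def: "I = (SIGMA b:{..<m}. {..<t b})"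
    and inj: "inj_on u I" and indep: "independent (u ` I)" and span: "span (u ` I) = UNIV"
  shows "cyclic_decomposition scale Basis N m t e"
proof
  have u: "u (b, l) = (N ^^ l) (e b)" for b l by (simp add: u_def)
  have u0: "u x \<noteq> 0" if "x \<in> I" for x
    using indep dependent_zero that by (metis image_eqI)
  show "endomorphism scale N" by (rule N)
  show "0 < t b" "(N ^^ t b) (e b) = 0" if "b < m" for b by (rule t[OF that])+
  show "(N ^^ (t b - 1)) (e b) \<noteq> 0" if "b < m" for b
    using u0[of "(b, t b - 1)"] t(1)[OF that] that by (simp add: u I_def)
  have "u ` I \<subseteq> {(N ^^ l) (e b) | b l. b < m}" unfolding I_def using u by blast
  from span_mono[OF this] show "span {(N ^^ l) (e b) | b l. b < m} = UNIV"
    by (simp add: span top.extremum_unique)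
  fix i w assume i: "i < m" and w: "(N ^^ t i) w = 0"
  define g where "g x = (case inv_into I u x of (b, l) \<Rightarrow> if b = i then (N ^^ l) w else 0)" for x
  interpret vp: vector_space_pair scale scale by unfold_locales
  obtain E where E: "Vector_Spaces.linear scale scale E" "\<And>x. x \<in> u ` I \<Longrightarrow> E x = g x"
    using vp.linear_independent_extend[OF indep, of g] by blast
  have E': "endomorphism scale E" using E(1) by (simp add: endomorphism_def)
  have N0: "N 0 = 0" by (rule endo_zero[OF N])
  have E_u: "E (u (b, l)) = (if b = i then (N ^^ l) w else 0)" if "b < m" "l < t b" for b l
  proof -
    have bl: "(b, l) \<in> I" using that by (simp add: I_def)
    have "E (u (b, l)) = g (u (b, l))" using bl by (intro E(2)) blast
    also have "\<dots> = (if b = i then (N ^^ l) w else 0)"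
      unfolding g_def inv_into_f_f[OF inj bl] by simp
    finally show ?thesis .
  qed
  have lin: "Vector_Spaces.linear scale scale (\<lambda>v. E (N v))"
    "Vector_Spaces.linear scale scale (\<lambda>v. N (E v))"
    using N E' by (simp_all add: endomorphism_def[symmetric] endomorphism_iff)
  have "E (N v) = N (E v)" for v
  proof (rule vp.linear_eq_on[OF lin])
    show "v \<in> span (u ` I)" unfolding span ..
    fix x assume "x \<in> u ` I"
    then obtain b l where x: "x = u (b, l)" and b: "b < m" "l < t b" by (auto simp: I_def)
    have Nx: "N x = u (b, Suc l)" by (simp add: x u)
    show "E (N x) = N (E x)"
    proof (cases "Suc l < t b")
      case True
      have "E (N x) = (if b = i then (N ^^ Suc l) w else 0)"
        unfolding Nx by (rule E_u[OF b(1) True])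
      also have "\<dots> = N (E x)"
        unfolding x using E_u[OF b] by (simp add: N0)
      finally show ?thesis .
    next
      case False
      with b have l: "Suc l = t b" by simp
      then have "N x = 0" using t(2)[OF b(1)] unfolding Nx by (simp add: u)
      moreover have "N (E x) = 0"
      proof (cases "b = i")
        case True
        have "N ((N ^^ l) w) = (N ^^ Suc l) w" by simp
        then show ?thesis using E_u[OF b] w l True unfolding x by simp
      next
        case False
        then show ?thesis using E_u[OF b] unfolding x by (simp add: N0)
      qed
      ultimately show ?thesis by (simp add: endo_zero[OF E'])
    qed
  qed
  then have "E \<in> centralizer scale N" using E' by (simp add: centralizer_def)
  moreover have "E (e b) = (if b = i then w else 0)" if "b < m" for b
    using E_u[OF that t(1)[OF that]] by (simp add: u)
  ultimately show "\<exists>E\<in>centralizer scale N. E (e i) = w \<and> (\<forall>b<m. b \<noteq> i \<longrightarrow> E (e b) = 0)"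
    using i by (intro bexI[of _ E]) auto
qed

text \<open>A longest independent list on which \<open>N\<close> maps each vector into the span of its predecessors must
  span the space: a vector outside could be pushed by \<open>N\<close> until it extends the list.\<close>

lemma ex_triangular_basis:
  assumes N: "endomorphism scale N" and nil: "\<And>v. (N ^^ k) v = 0"
  obtains bs where "ordered_basis scale bs"
    "\<And>j. j < length bs \<Longrightarrow> N (bs ! j) \<in> span (set (take j bs))"
proof -
  define flag where "flag bs \<longleftrightarrow> distinct bs \<and> independent (set bs) \<and>
    (\<forall>j<length bs. N (bs ! j) \<in> span (set (take j bs)))" for bs
  have "length bs \<le> dim (UNIV :: 'b set)" if "flag bs" for bs
    using that independent_card_le_dim[of "set bs" UNIV] by (auto simp: flag_def distinct_card)
  moreover have "flag []" by (simp add: flag_def independent_empty)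
  ultimately obtain bs where bs: "flag bs" and max: "\<And>cs. flag cs \<Longrightarrow> length cs \<le> length bs"
    using ex_has_greatest_nat[of flag "[]" length "Suc (dim (UNIV :: 'b set))"]
      by (metis le_imp_less_Suc)
  have "span (set bs) = UNIV"
  proof (rule ccontr)
    assume "span (set bs) \<noteq> UNIV"
    then obtain v where v: "v \<notin> span (set bs)" by blast
    \<comment> \<open>Apply \<open>N\<close> to a vector outside the span until just before it enters the span.\<close>
    define l where "l = (LEAST l. (N ^^ l) v \<in> span (set bs))"
    have "(N ^^ k) v \<in> span (set bs)" by (simp add: nil span_zero)
    then have l: "(N ^^ l) v \<in> span (set bs)" unfolding l_def by (rule LeastI)
    then obtain l' where l': "l = Suc l'" using v by (cases l) auto
    define w where "w = (N ^^ l') v"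
    have w: "w \<notin> span (set bs)" unfolding w_def using not_less_Least[of l' "\<lambda>l. (N ^^ l) v \<in> span (set bs)"] l'
      by (simp add: l_def)
    have Nw: "N w \<in> span (set bs)" using l by (simp add: w_def l')
    have "flag (bs @ [w])"
      using bs w Nw span_base[of w "set bs"]
      by (auto simp: flag_def nth_append independent_insertI less_Suc_eq)
    from max[OF this] show False by simp
  qed
  then show thesis using bs that by (auto simp: flag_def ordered_basis_def)
qed

text \<open>In a basis adapted to the nilpotent part the matrix is triangular, and over any field a triangular
  matrix has a Jordan form.\<close>

lemma ex_jordan_form:
  assumes A: "endomorphism scale A" and nil: "\<And>v. ((\<lambda>v. A v - scale a v) ^^ k) v = 0"
  shows "\<exists>n_as. jordan_form scale A n_as"
proof -
  have N: "endomorphism scale (\<lambda>v. A v - scale a v)"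
    using centralizer_diff[OF A centralizer_self[OF A] centralizer_scale[OF A]]
    by (rule centralizer_endo)
  obtain bs where bs: "ordered_basis scale bs"
    "\<And>j. j < length bs \<Longrightarrow> A (bs ! j) - scale a (bs ! j) \<in> span (set (take j bs))"
    using ex_triangular_basis[OF N nil] by blast
  from bs(1) have dist: "distinct bs" and indep: "independent (set bs)"
    by (auto simp: ordered_basis_def)
  let ?M = "matrix_of_endo scale bs A"
  have "upper_triangular ?M"
  proof
    fix i j assume ji: "j < i" and "i < dim_row ?M"
    then have i: "i < length bs" and j: "j < length bs" by (auto simp: matrix_of_endo_def)
    let ?B = "set (take (Suc j) bs)"
    have bj: "bs ! j \<in> ?B" using j by (simp add: take_Suc_conv_app_nth)
    have "set (take j bs) \<subseteq> ?B" by (rule set_take_subset_set_take) simp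
    then have "A (bs ! j) - scale a (bs ! j) \<in> span ?B" using bs(2)[OF j] span_mono by blast
    from span_add[OF this span_scale[OF span_base[OF bj]]]
    have "A (bs ! j) - scale a (bs ! j) + scale a (bs ! j) \<in> span ?B" .
    then have "A (bs ! j) \<in> span ?B" by simp
    then have "representation (set bs) (A (bs ! j)) = representation ?B (A (bs ! j))"
      by (rule representation_extend[OF indep _ set_take_subset])
    moreover have "bs ! i \<notin> ?B"
      using ji i dist by (auto simp: in_set_conv_nth nth_eq_iff_index_eq)
    ultimately have "representation (set bs) (A (bs ! j)) (bs ! i) = 0"
      using representation_ne_zero by metis
    then show "?M $$ (i, j) = 0" using i j by (simp add: matrix_of_endo_def)
  qed
  then have "jordan_nf ?M (triangular_to_jnf_vector ?M)"
    by (intro triangular_to_jnf_vector[of _ "length bs"]) (simp_all add: matrix_of_endo_def)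
  then show ?thesis using bs(1) unfolding jordan_form_def by blast
qed

lemma sum_jordan_block:
  assumes "j < n"
  shows "(\<Sum>i<n. scale (jordan_block n c $$ (i, j)) (g i)) =
    scale c (g j) + (if j = 0 then 0 else g (j - 1))"
proof -
  have "(\<Sum>i<n. scale (jordan_block n c $$ (i, j)) (g i)) =
      (\<Sum>i<n. (if i = j then scale c (g i) else 0) + (if Suc i = j then g i else 0))"
    using assms by (intro sum.cong) auto
  also have "\<dots> = scale c (g j) + (\<Sum>i<n. if Suc i = j then g i else 0)"
    using assms by (simp add: sum.distrib)
  also have "(\<Sum>i<n. if Suc i = j then g i else 0) = (if j = 0 then 0 else g (j - 1))"
  proof (cases j)
    case (Suc j')
    then have "(\<Sum>i<n. if Suc i = j then g i else 0) = (\<Sum>i<n. if i = j' then g i else 0)"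
      by (intro sum.cong) auto
    then show ?thesis using Suc assms by simp
  qed simp
  finally show ?thesis .
qed

text \<open>Cuts a list of vectors on which \<open>A\<close> acts by a block diagonal Jordan matrix into the lists belonging
  to the single blocks. The ones of a block lie above the diagonal, so \<open>A\<close> maps each vector to a
  multiple of itself plus its predecessor.\<close>

lemma jordan_chains:
  assumes "length fs = sum_list (map fst n_as)"
    and "\<And>j. j < length fs \<Longrightarrow> A (fs ! j) = (\<Sum>i<length fs. scale (jordan_matrix n_as $$ (i, j)) (fs ! i))"
  shows "\<exists>css. fs = concat css \<and> list_all2 (\<lambda>cs (n, c). length cs = n \<and>
    (\<forall>l<n. A (cs ! l) = scale c (cs ! l) + (if l = 0 then 0 else cs ! (l - 1)))) css n_as"
  using assms
proof (induction n_as arbitrary: fs)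
  case (Cons x n_as)
  obtain n c where x: "x = (n, c)" by (cases x)
  define n' where "n' = sum_list (map fst n_as)"
  let ?J = "jordan_matrix n_as"
  have len: "length fs = n + n'" using Cons.prems(1) by (simp add: x n'_def)
  have J: "jordan_matrix (x # n_as) = four_block_mat (jordan_block n c) (0\<^sub>m n n') (0\<^sub>m n' n) ?J"
    by (simp add: x jordan_matrix_Cons n'_def)
  let ?M = "jordan_matrix (x # n_as)"
  have entry: "i < n \<Longrightarrow> j < n \<Longrightarrow> ?M $$ (i, j) = jordan_block n c $$ (i, j)"
    "i' < n' \<Longrightarrow> j < n \<Longrightarrow> ?M $$ (n + i', j) = 0"
    "i < n \<Longrightarrow> j' < n' \<Longrightarrow> ?M $$ (i, n + j') = 0"
    "i' < n' \<Longrightarrow> j' < n' \<Longrightarrow> ?M $$ (n + i', n + j') = ?J $$ (i', j')" for i j i' j'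
    unfolding J by (simp_all add: n'_def[symmetric])
  have split: "(\<Sum>i<n + n'. g i) = (\<Sum>i<n. g i) + (\<Sum>i<n'. g (n + i))" for g :: "nat \<Rightarrow> 'b"
    by (induction n') (simp_all add: add.assoc)
  have block: "A (fs ! j) = scale c (fs ! j) + (if j = 0 then 0 else fs ! (j - 1))" if "j < n" for j
  proof -
    have "A (fs ! j) = (\<Sum>i<n. scale (jordan_block n c $$ (i, j)) (fs ! i))"
      using Cons.prems(2)[of j] that unfolding len split by (simp add: entry)
    then show ?thesis using sum_jordan_block[OF that, of c "\<lambda>i. fs ! i"] by simp
  qed
  have rest: "A (drop n fs ! j) = (\<Sum>i<length (drop n fs). scale (?J $$ (i, j)) (drop n fs ! i))"
    if "j < length (drop n fs)" for j
    using Cons.prems(2)[of "n + j"] that unfolding len split by (simp add: entry len)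
  obtain css where css: "drop n fs = concat css" "list_all2 (\<lambda>cs (n, c). length cs = n \<and>
    (\<forall>l<n. A (cs ! l) = scale c (cs ! l) + (if l = 0 then 0 else cs ! (l - 1)))) css n_as"
    using Cons.IH[of "drop n fs"] rest len by (auto simp: n'_def)
  show ?case
  proof (intro exI[of _ "take n fs # css"] conjI)
    show "fs = concat (take n fs # css)" using css(1) append_take_drop_id[of n fs] by simp
    show "list_all2 (\<lambda>cs (n, c). length cs = n \<and>
      (\<forall>l<n. A (cs ! l) = scale c (cs ! l) + (if l = 0 then 0 else cs ! (l - 1)))) (take n fs # css) (x # n_as)"
      using css(2) len block by (simp add: x)
  qed
qed (auto intro!: exI[of _ "[]"])

text \<open>Linear combinations with the columns of a product are combinations of combinations; this turns
  similarity of matrices into a change of basis.\<close>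

lemma sum_mult_mat:
  assumes X: "X \<in> carrier_mat n n" and Y: "Y \<in> carrier_mat n n" and j: "j < n"
  shows "(\<Sum>i<n. scale ((X * Y) $$ (i, j)) (g i)) =
    (\<Sum>l<n. scale (Y $$ (l, j)) (\<Sum>i<n. scale (X $$ (i, l)) (g i)))"
proof -
  have "(\<Sum>i<n. scale ((X * Y) $$ (i, j)) (g i)) =
      (\<Sum>i<n. \<Sum>l<n. scale (X $$ (i, l) * Y $$ (l, j)) (g i))"
  proof (rule sum.cong)
    fix i assume "i \<in> {..<n}"
    then have "(X * Y) $$ (i, j) = (\<Sum>l<n. X $$ (i, l) * Y $$ (l, j))"
      using X Y j by (simp add: scalar_prod_def lessThan_atLeast0)
    then show "scale ((X * Y) $$ (i, j)) (g i) = (\<Sum>l<n. scale (X $$ (i, l) * Y $$ (l, j)) (g i))"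
      by (simp add: scale_sum_left)
  qed simp
  also have "\<dots> = (\<Sum>l<n. \<Sum>i<n. scale (X $$ (i, l) * Y $$ (l, j)) (g i))" by (rule sum.swap)
  also have "\<dots> = (\<Sum>l<n. scale (Y $$ (l, j)) (\<Sum>i<n. scale (X $$ (i, l)) (g i)))"
    by (simp add: scale_sum_right mult.commute)
  finally show ?thesis .
qed

lemma jordan_form_basis:
  assumes A: "endomorphism scale A" and jf: "jordan_form scale A n_as"
  obtains fs where "ordered_basis scale fs" "length fs = sum_list (map fst n_as)"
    "\<And>j. j < length fs \<Longrightarrow> A (fs ! j) = (\<Sum>i<length fs. scale (jordan_matrix n_as $$ (i, j)) (fs ! i))"
    "0 \<notin> fst ` set n_as"
proof -
  let ?J = "jordan_matrix n_as"
  obtain bs where bs: "ordered_basis scale bs" and jnf: "jordan_nf (matrix_of_endo scale bs A) n_as"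
    using jf unfolding jordan_form_def by blast
  define M where "M = matrix_of_endo scale bs A"
  define n where "n = length bs"
  have M: "M \<in> carrier_mat n n" by (simp add: M_def matrix_of_endo_def n_def)
  obtain P Q where wit: "similar_mat_wit M ?J P Q" and n0: "0 \<notin> fst ` set n_as"
    using jnf unfolding jordan_nf_def similar_mat_def M_def by blast
  note w = similar_mat_witD2[OF M wit]
  have PJ: "P * ?J \<in> carrier_mat n n" by (rule mult_carrier_mat[OF w(6,5)])
  have "M * P = P * ?J * (Q * P)"
    by (subst w(3)) (rule assoc_mult_mat[OF PJ w(7,6)])
  then have MP: "M * P = P * ?J" by (simp only: w(2) right_mult_one_mat[OF PJ])
  from bs have dist: "distinct bs" and indep: "independent (set bs)" and span: "span (set bs) = UNIV"
    by (auto simp: ordered_basis_def)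
  have Abs: "A (bs ! j) = (\<Sum>i<n. scale (M $$ (i, j)) (bs ! i))" if "j < n" for j
  proof -
    have "A (bs ! j) = (\<Sum>b\<in>set bs. scale (representation (set bs) (A (bs ! j)) b) b)"
      by (rule sum_representation_eq[symmetric]) (auto simp: indep span)
    also have "\<dots> = (\<Sum>i<n. scale (representation (set bs) (A (bs ! j)) (bs ! i)) (bs ! i))"
      by (rule sum.reindex_bij_betw[OF bij_betw_nth[OF dist], symmetric]) (auto simp: n_def)
    also have "\<dots> = (\<Sum>i<n. scale (M $$ (i, j)) (bs ! i))"
      using that by (intro sum.cong) (auto simp: M_def matrix_of_endo_def n_def)
    finally show ?thesis .
  qed
  define f where "f j = (\<Sum>i<n. scale (P $$ (i, j)) (bs ! i))" for j
  define fs where "fs = map f [0..<n]"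
  have len: "length fs = n" and nth: "\<And>j. j < n \<Longrightarrow> fs ! j = f j" by (simp_all add: fs_def)
  have Af: "A (f j) = (\<Sum>i<n. scale (?J $$ (i, j)) (f i))" if "j < n" for j
  proof -
    have "A (f j) = (\<Sum>l<n. scale (P $$ (l, j)) (\<Sum>i<n. scale (M $$ (i, l)) (bs ! i)))"
      by (simp add: f_def endo_sum[OF A] endo_scale[OF A] Abs)
    also have "\<dots> = (\<Sum>i<n. scale ((M * P) $$ (i, j)) (bs ! i))"
      by (rule sum_mult_mat[OF M w(6) that, symmetric])
    also have "\<dots> = (\<Sum>l<n. scale (?J $$ (l, j)) (f l))"
      unfolding MP f_def by (rule sum_mult_mat[OF w(6,5) that])
    finally show ?thesis .
  qed
  have "bs ! j \<in> span (set fs)" if "j < n" for j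
  proof -
    have "bs ! j = (\<Sum>i<n. if i = j then bs ! i else 0)" using that by simp
    also have "\<dots> = (\<Sum>i<n. scale ((P * Q) $$ (i, j)) (bs ! i))"
      unfolding w(1) using that by (intro sum.cong) auto
    also have "\<dots> = (\<Sum>l<n. scale (Q $$ (l, j)) (f l))"
      unfolding f_def by (rule sum_mult_mat[OF w(6,7) that])
    also have "\<dots> \<in> span (set fs)"
      by (intro span_sum span_scale span_base) (auto simp: fs_def)
    finally show ?thesis .
  qed
  then have "set bs \<subseteq> span (set fs)" by (auto simp: in_set_conv_nth n_def)
  then have span': "span (set fs) = UNIV" using span span_minimal[OF _ subspace_span] by blast
  have "dim (UNIV :: 'b set) = card (set bs)" using dim_eq_card[OF _ indep, of UNIV] span by simp
  then have d: "dim (UNIV :: 'b set) = n" using dist by (simp add: distinct_card n_def)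
  have "n \<le> card (set fs)" using span_card_ge_dim[of "set fs" UNIV] span' d by simp
  then have c: "card (set fs) = n" using card_length[of fs] len by simp
  have "independent (set fs)"
    using card_le_dim_spanning[of "set fs" UNIV] span' c d by simp
  moreover have "distinct fs" using c len by (simp add: card_distinct)
  ultimately have "ordered_basis scale fs" using span' by (simp add: ordered_basis_def)
  moreover have "length fs = sum_list (map fst n_as)"
    using carrier_matD(1)[OF w(5)] by (simp add: len)
  moreover have "A (fs ! j) = (\<Sum>i<length fs. scale (?J $$ (i, j)) (fs ! i))" if "j < length fs" for j
    using that Af[of j] by (simp add: len nth)
  ultimately show thesis using n0 by (rule that)
qed

text \<open>Each block yields a Jordan chain, that is the powers of its last vector in reverse order. Its
  eigenvalue must be \<open>a\<close>, since \<open>N\<close> is nilpotent but multiplies the eigenvector of the chain by the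
  difference.\<close>

lemma jordan_form_cyclic_decomposition:
  assumes A: "endomorphism scale A" and jf: "jordan_form scale A n_as"
    and N_def: "N = (\<lambda>v. A v - scale a v)" and nil: "\<And>v. (N ^^ k) v = 0"
  obtains e where "cyclic_decomposition scale Basis N (length n_as) (\<lambda>b. fst (n_as ! b)) e"
proof -
  have N: "endomorphism scale N"
    using centralizer_diff[OF A centralizer_self[OF A] centralizer_scale[OF A]]
    unfolding N_def by (rule centralizer_endo)
  obtain fs where fs: "ordered_basis scale fs" "length fs = sum_list (map fst n_as)"
    "\<And>j. j < length fs \<Longrightarrow> A (fs ! j) = (\<Sum>i<length fs. scale (jordan_matrix n_as $$ (i, j)) (fs ! i))"
    and n0: "0 \<notin> fst ` set n_as"
    by (rule jordan_form_basis[OF A jf], rule that)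
  from jordan_chains[OF fs(2,3)] obtain css where fs_css: "fs = concat css"
    and css: "list_all2 (\<lambda>cs (n, c). length cs = n \<and>
      (\<forall>l<n. A (cs ! l) = scale c (cs ! l) + (if l = 0 then 0 else cs ! (l - 1)))) css n_as"
    by blast
  from fs(1) have dist: "distinct fs" and indep: "independent (set fs)" and span: "span (set fs) = UNIV"
    by (auto simp: ordered_basis_def)
  define m where "m = length n_as"
  define t where "t b = fst (n_as ! b)" for b
  have m: "length css = m" using list_all2_lengthD[OF css] by (simp add: m_def)
  have len: "length (css ! b) = t b"
    and chain: "\<And>l. l < t b \<Longrightarrow> A (css ! b ! l) =
      scale (snd (n_as ! b)) (css ! b ! l) + (if l = 0 then 0 else css ! b ! (l - 1))"
    if "b < m" for b
    using list_all2_nthD[OF css, of b] that m by (auto simp: t_def split: prod.splits)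
  have t_pos: "0 < t b" if "b < m" for b
    using n0 that by (force simp: t_def m_def in_set_conv_nth)
  have in_fs: "css ! b ! l \<in> set fs" if "b < m" "l < t b" for b l
  proof -
    have "css ! b \<in> set css" "css ! b ! l \<in> set (css ! b)" using that len m by simp_all
    then show ?thesis unfolding fs_css set_concat by blast
  qed
  have eig: "snd (n_as ! b) = a" if b: "b < m" for b
  proof -
    define x c where "x = css ! b ! 0" and "c = snd (n_as ! b) - a"
    have "x \<noteq> 0" using in_fs[OF b t_pos[OF b]] indep dependent_zero by (auto simp: x_def)
    have "N x = scale c x"
      using chain[OF b t_pos[OF b]] by (simp add: N_def x_def c_def scale_left_diff_distrib)
    then have "(N ^^ i) x = scale (c ^ i) x" for i
      by (induction i) (simp_all add: endo_scale[OF N] mult.commute)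
    then have "scale (c ^ k) x = 0" using nil[of x] by simp
    then show ?thesis using \<open>x \<noteq> 0\<close> by (simp add: c_def)
  qed
  have Nchain: "N (css ! b ! l) = (if l = 0 then 0 else css ! b ! (l - 1))" if "b < m" "l < t b" for b l
    using chain[OF that] eig[OF that(1)] by (simp add: N_def)
  \<comment> \<open>A Jordan chain starts with its eigenvector, so its last vector generates it.\<close>
  define e where "e b = css ! b ! (t b - 1)" for b
  have Ne: "(N ^^ l) (e b) = css ! b ! (t b - 1 - l)" if "b < m" "l < t b" for b l
    using that(2)
  proof (induction l)
    case (Suc l)
    then show ?case using Nchain[OF that(1), of "t b - 1 - l"] by simp
  qed (simp add: e_def)
  have Nt: "(N ^^ t b) (e b) = 0" if b: "b < m" for b
  proof -
    obtain l where "t b = Suc l" using t_pos[OF b] by (cases "t b") auto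
    then show ?thesis using Ne[OF b, of l] Nchain[OF b, of 0] by simp
  qed
  define I where "I = (SIGMA b:{..<m}. {..<t b})"
  define u where "u = (\<lambda>(b, l). (N ^^ l) (e b))"
  have u: "u (b, l) = css ! b ! (t b - 1 - l)" if "b < m" "l < t b" for b l
    using Ne[OF that] by (simp add: u_def)
  have image: "u ` I = set fs"
  proof
    show "u ` I \<subseteq> set fs" using u in_fs by (auto simp: I_def)
    show "set fs \<subseteq> u ` I"
    proof
      fix x assume "x \<in> set fs"
      then obtain b l where b: "b < m" "l < t b" "x = css ! b ! l"
        unfolding fs_css using m len by (auto simp: in_set_conv_nth)
      then have "x = u (b, t b - 1 - l)" using u[of b "t b - 1 - l"] by simp
      moreover have "(b, t b - 1 - l) \<in> I" using b by (simp add: I_def)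
      ultimately show "x \<in> u ` I" by blast
    qed
  qed
  have "card I = length fs"
  proof -
    have "card I = (\<Sum>b<m. t b)" by (simp add: I_def)
    also have "\<dots> = sum_list (map fst n_as)"
      by (simp add: m_def t_def sum_list_sum_nth lessThan_atLeast0)
    finally show ?thesis by (simp add: fs(2))
  qed
  then have "inj_on u I"
    using eq_card_imp_inj_on[of I u] image dist by (simp add: distinct_card I_def)
  then have "cyclic_decomposition scale Basis N m t e"
    using cyclic_decompositionI[of N m t e I] N t_pos Nt I_def indep span
    unfolding image[symmetric] unfolding u_def by blast
  then show thesis using that unfolding m_def t_def by blast
qed

end

section \<open>Characteristic subspaces that are not hyperinvariant\<close>

lemma num_blocks_eq_1_iff:
  "num_blocks n_as x = 1 \<longleftrightarrow> (\<exists>!b. b < length n_as \<and> fst (n_as ! b) = x)"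
proof -
  have "num_blocks n_as x = card {b. b < length n_as \<and> fst (n_as ! b) = x}"
    unfolding num_blocks_def count_list_eq_length_filter length_filter_conv_card
    by (rule arg_cong[of _ _ card]) auto
  moreover have "(\<exists>y. {b. R b} = {y}) \<longleftrightarrow> (\<exists>!b. R b)" for R :: "nat \<Rightarrow> bool"
    unfolding set_eq_iff mem_Collect_eq singleton_iff by metis
  ultimately show ?thesis by (simp only: One_nat_def card_1_singleton_iff)
qed

lemma (in cyclic_decomposition) ex1_order_iff:
  "(\<exists>!b. b < m \<and> t b = x) \<longleftrightarrow> (\<exists>b. unrepeated b \<and> t b = x)"
  unfolding unrepeated_def by metis

theorem corollary3p5:
  fixes scale :: "'f::field \<Rightarrow> 'v::ab_group_add \<Rightarrow> 'v"
    and Basis :: "'v set"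
    and A :: "'v \<Rightarrow> 'v"
    and p :: "'f poly"
    and k :: nat
  assumes "finite_dimensional_vector_space scale Basis"
    and "endomorphism scale A"
    and "k \<ge> 1"
    and "irreducible p"
    and "separable_poly p"
    and "is_minimal_polynomial scale A (p ^ k)"
  shows "Chinv scale A - Hinv scale A \<noteq> {} \<longleftrightarrow>
    card (UNIV :: 'f set) = 2 \<and> degree p = 1 \<and>
    (\<exists>n_as r s. jordan_form scale A n_as \<and> 0 < r \<and> 0 < s \<and> s > r + 1 \<and>
       num_blocks n_as s = 1 \<and> num_blocks n_as r = 1)"
proof -
  interpret finite_dimensional_vector_space scale Basis by fact
  note A = \<open>endomorphism scale A\<close>
  have pk: "poly_endo scale (p ^ k) A v = 0" for v
    using assms(6) by (auto simp: is_minimal_polynomial_def)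
  have ex_Y: "Chinv scale A - Hinv scale A \<noteq> {} \<longleftrightarrow>
      (\<exists>Y. characteristic scale A Y \<and> \<not> hyperinvariant scale A Y)"
    by (auto simp: Chinv_iff Hinv_iff)
  show ?thesis
  proof (cases "card (UNIV :: 'f set) = 2 \<and> degree p = 1")
    case False
    then have "hyperinvariant scale A Y" if "characteristic scale A Y" for Y
      using characteristic_imp_hyperinvariant[OF that A assms(4) pk] by blast
    with False show ?thesis unfolding ex_Y by blast
  next
    case True
    have F2: "c = 0 \<or> c = 1" for c :: 'f
    proof (rule ccontr)
      assume "\<not> ?thesis"
      then have "card {0, 1, c} = 3" by auto
      moreover have "card {0, 1, c} \<le> card (UNIV :: 'f set)"
        using True by (intro card_mono card_ge_0_finite) auto
      ultimately show False using True by simp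
    qed
    from True have "degree p = 1" by simp
    then obtain c1 c0 where "p = [:c0, c1:]" "c1 \<noteq> 0" by (rule degree1_coeffs)
    then have p: "p = [:- (- c0), 1:]" using F2[of c1] by simp
    define N where "N = (\<lambda>v. A v - scale (- c0) v)"
    have nil: "(N ^^ k) v = 0" for v
      using pk[of v] poly_endo_linear_power[OF A, of "- c0" k v] unfolding p N_def by simp
    have ex_N: "Chinv scale A - Hinv scale A \<noteq> {} \<longleftrightarrow>
        (\<exists>Y. characteristic scale N Y \<and> \<not> hyperinvariant scale N Y)"
      unfolding ex_Y N_def characteristic_shift[OF A] hyperinvariant_shift[OF A] ..
    have "(\<exists>Y. characteristic scale N Y \<and> \<not> hyperinvariant scale N Y) \<longleftrightarrow>
      (\<exists>n_as r s. jordan_form scale A n_as \<and> 0 < r \<and> 0 < s \<and> s > r + 1 \<and>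
       num_blocks n_as s = 1 \<and> num_blocks n_as r = 1)"
    proof
      assume "\<exists>Y. characteristic scale N Y \<and> \<not> hyperinvariant scale N Y"
      then obtain Y where Y: "characteristic scale N Y" "\<not> hyperinvariant scale N Y" by blast
      obtain n_as where jf: "jordan_form scale A n_as"
        using ex_jordan_form[OF A nil[unfolded N_def]] by blast
      obtain e where "cyclic_decomposition scale Basis N (length n_as) (\<lambda>b. fst (n_as ! b)) e"
        using jordan_form_cyclic_decomposition[OF A jf N_def nil] .
      then interpret cd: cyclic_decomposition scale Basis N "length n_as" "\<lambda>b. fst (n_as ! b)" e .
      obtain i j where i: "cd.unrepeated i" and j: "cd.unrepeated j"
        and ij: "\<not> fst (n_as ! j) \<le> fst (n_as ! i) + 1"
        using cd.characteristic_imp_hyperinvariant_if_no_gap[OF Y(1)] Y(2) by fast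
      have num: "num_blocks n_as (fst (n_as ! b)) = 1" if "cd.unrepeated b" for b
        unfolding num_blocks_eq_1_iff cd.ex1_order_iff by (intro exI[of _ b] conjI that refl)
      have pos: "0 < fst (n_as ! b)" if "cd.unrepeated b" for b
        using that unfolding cd.unrepeated_def by (elim conjE) (rule cd.t_pos)
      show "\<exists>n_as r s. jordan_form scale A n_as \<and> 0 < r \<and> 0 < s \<and> s > r + 1 \<and>
        num_blocks n_as s = 1 \<and> num_blocks n_as r = 1"
        by (intro exI[of _ n_as] exI[of _ "fst (n_as ! i)"] exI[of _ "fst (n_as ! j)"] conjI
            jf num pos i j) (use ij in simp)
    next
      assume "\<exists>n_as r s. jordan_form scale A n_as \<and> 0 < r \<and> 0 < s \<and> s > r + 1 \<and>
        num_blocks n_as s = 1 \<and> num_blocks n_as r = 1"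
      then obtain n_as r s where jf: "jordan_form scale A n_as" and rs: "s > r + 1"
        and num: "num_blocks n_as s = 1" "num_blocks n_as r = 1" by blast
      obtain e where "cyclic_decomposition scale Basis N (length n_as) (\<lambda>b. fst (n_as ! b)) e"
        using jordan_form_cyclic_decomposition[OF A jf N_def nil] .
      then interpret cd: cyclic_decomposition scale Basis N "length n_as" "\<lambda>b. fst (n_as ! b)" e .
      have ex: "\<exists>b. cd.unrepeated b \<and> fst (n_as ! b) = x" if "num_blocks n_as x = 1" for x
        using that unfolding num_blocks_eq_1_iff cd.ex1_order_iff .
      obtain i where i: "cd.unrepeated i" "fst (n_as ! i) = r" using ex[OF num(2)]
        by (elim exE conjE)
      obtain j where j: "cd.unrepeated j" "fst (n_as ! j) = s" using ex[OF num(1)]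
        by (elim exE conjE)
      show "\<exists>Y. characteristic scale N Y \<and> \<not> hyperinvariant scale N Y"
        by (rule cd.gap_imp_characteristic_not_hyperinvariant[OF F2 i(1) j(1)])
          (simp only: i(2) j(2) rs)
    qed
    then show ?thesis unfolding ex_N using True by simp
  qed
qed

end
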